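(* Let $A$ be a Nakayama algebra of order $n$ over a field $k$ with the length grading, let $w$ be the weight of its resolution quiver $R_A$, and let $\alpha(t)=(\alpha_a(t))_{1\le a\le n}$ be the unique weighting on the graded Cartan matrix $C_A(t)$ over $\mathbb{Q}(t)$. For a vertex $a$ let $n_a$ be the number of vertices of the connected component of $R_A$ containing $a$. Then: (1) if $a$ is not cyclic (in $R_A$), then $\alpha_a(1)=0$; (2) if $a$ is cyclic, then $\alpha_a(1)=\dfrac{n_a}{nw}$.
   Context: Fix a field $k$; all modules are finite dimensional right modules. Let $\Delta_n$ ($n\ge 1$) be the cyclic quiver with vertices $1,\dots,n$ and arrows $x_a\colon a\to a+1$ for $1\le a\le n-1$ and $x_n\colon n\to 1$. A Nakayama algebra of order $n$ is a finite dimensional algebra $A$ isomorphic to the quotient of the path algebra $k\Delta_n$ by an ideal generated by a finite set of nontrivial paths (arrows are allowed in this set). For a vertex $a$, let $e_a$ be the idempotent, $S_a$ the simple module and $P_a=e_aA$ the indecomposable projective module at $a$; paths are composed so that $e_aA$ is spanned by the paths starting at $a$. Put $p_a=\dim_k P_a$. Let $\tau(a)=a+1$ for $1\le a\le n-1$ and $\tau(n)=1$. The resolution quiver $R_A$ has vertices $1,\dots,n$ and a unique arrow $a\to\gamma(a)$ for each $a$, where $\gamma(a)=\tau^{p_a}(a)$. A vertex is cyclic if it lies on a cycle of $R_A$. The weight of a cycle $I$ is $w=\frac1n\sum_{a\in I}p_a$; it is an integer independent of the cycle chosen and is called the weight of $R_A$. The length grading on $A$ is the grading in which every arrow $x_a$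 has degree $1$; $A_\ell$ denotes the degree $\ell$ part. The graded Cartan matrix $C_A(t)=(c_{ab}(t))$ has entries $c_{ab}(t)=\sum_\ell\dim_k(e_bA_\ell e_a)t^\ell$. Since $C_A(0)$ is the identity matrix, $C_A(t)$ is invertible over the field $\mathbb{Q}(t)$ of rational functions. A weighting on an $n\times n$ matrix $C$ is a column vector $\alpha$ with $C\alpha=u$, where $u$ is the column vector with all entries $1$. $\alpha_a(1)$ denotes the value at $t=1$ of the rational function $\alpha_a(t)$ (which is defined there). *)

theory Defs
  imports
    "HOL-Computational_Algebra.Polynomial"
    "HOL-Computational_Algebra.Fraction_Field"
    "HOL-Library.Groups_Big_Fun"
    "Graph_Theory.Graph_Theory"
    "HOL-Algebra.Embedded_Algebras"
    "HOL-Algebra.QuotRing"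
begin

section \<open>Path algebras\<close>

text \<open>
  Quivers are the multigraphs of \<^theory>\<open>Graph_Theory.Digraph\<close>. A path is a pair of its source
  and its list of arrows; the source is recorded because of the trivial paths \<open>(u, [])\<close>.
\<close>

definition quiver_paths :: "('v, 'e) pre_digraph \<Rightarrow> ('v \<times> 'e list) set" where
  "quiver_paths Q = {(u, p). \<exists>v. pre_digraph.awalk Q u p v}"

definition path_target :: "('v, 'e) pre_digraph \<Rightarrow> 'v \<Rightarrow> 'e list \<Rightarrow> 'v" where
  "path_target Q u p = last (pre_digraph.awalk_verts Q u p)"

definition single_path :: "'v \<times> 'e list \<Rightarrow> 'v \<times> 'e list \<Rightarrow> 'k::field" where
  "single_path p = (\<lambda>q. if q = p then 1 else 0)"

text \<open>
  Elements are finitely supported coefficient functions on paths. In the product, the coefficient of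
  a path sums over all ways to cut it into an initial and a final part, so that \<open>pq\<close> means
  \<open>p\<close> followed by \<open>q\<close>.
\<close>

definition path_algebra :: "('v, 'e) pre_digraph \<Rightarrow> ('v \<times> 'e list \<Rightarrow> 'k::field) ring" where
  "path_algebra Q =
    \<lparr> carrier = {f. finite {p. f p \<noteq> 0} \<and> {p. f p \<noteq> 0} \<subseteq> quiver_paths Q},
      mult = (\<lambda>f g (u, p). \<Sum>i\<le>length p.
                f (u, take i p) * g (path_target Q u (take i p), drop i p)),
      one = (\<lambda>(u, p). if u \<in> verts Q \<and> p = [] then 1 else 0),
      zero = (\<lambda>_. 0),
      add = (\<lambda>f g p. f p + g p) \<rparr>"

definition path_algebra_scalar :: "('v, 'e) pre_digraph \<Rightarrow> 'k::field \<Rightarrow> ('v \<times> 'e list \<Rightarrow> 'k)" where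
  "path_algebra_scalar Q c = (\<lambda>p. c * \<one>\<^bsub>path_algebra Q\<^esub> p)"

definition path_algebra_degree ::
    "('v, 'e) pre_digraph \<Rightarrow> nat \<Rightarrow> ('v \<times> 'e list \<Rightarrow> 'k::field) set" where
  "path_algebra_degree Q l =
    {f \<in> carrier (path_algebra Q). \<forall>u p. f (u, p) \<noteq> 0 \<longrightarrow> length p = l}"

lemma path_target_simps:
  "path_target Q u [] = u"
  "path_target Q u (p @ q) = path_target Q (path_target Q u p) q"
  by (simp_all add: path_target_def pre_digraph.awalk_verts_conv)

lemma path_target_take_add:
  "path_target Q u (take (j + k) p) = path_target Q (path_target Q u (take j p)) (take k (drop j p))"
  by (simp add: take_add path_target_simps)

lemma quiver_paths_append:
  assumes "wf_digraph Q"
  shows "(u, p @ q) \<in> quiver_paths Q \<longleftrightarrow>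
    (u, p) \<in> quiver_paths Q \<and> (path_target Q u p, q) \<in> quiver_paths Q"
proof -
  interpret wf_digraph Q by fact
  show ?thesis
    by (auto simp: quiver_paths_def path_target_def)
qed

lemma quiver_paths_source: "(u, p) \<in> quiver_paths Q \<Longrightarrow> u \<in> verts Q"
  by (auto simp: quiver_paths_def pre_digraph.awalk_def)

lemma quiver_paths_target:
  assumes "wf_digraph Q" "(u, p) \<in> quiver_paths Q"
  shows "path_target Q u p \<in> verts Q"
  using quiver_paths_append[OF assms(1), of u p "[]"] assms(2) quiver_paths_source by fastforce

lemma path_algebra_ring:
  fixes Q :: "('v, 'e) pre_digraph"
  assumes wf: "wf_digraph Q" and fin: "finite (verts Q)"
  shows "ring (path_algebra Q :: ('v \<times> 'e list \<Rightarrow> 'k::field) ring)"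
proof -
  let ?R = "path_algebra Q :: ('v \<times> 'e list \<Rightarrow> 'k) ring"
  note d = path_algebra_def
  have mult_apply: "(f \<otimes>\<^bsub>?R\<^esub> g) (u, p) =
      (\<Sum>i\<le>length p. f (u, take i p) * g (path_target Q u (take i p), drop i p))" for f g u p
    by (simp add: d)
  have mclosed: "f \<otimes>\<^bsub>?R\<^esub> g \<in> carrier ?R" if "f \<in> carrier ?R" "g \<in> carrier ?R" for f g
  proof -
    let ?F = "{p. f p \<noteq> 0}" and ?G = "{p. g p \<noteq> 0}"
    have sub: "\<exists>q r. (u, q) \<in> ?F \<and> (path_target Q u q, r) \<in> ?G \<and> p = q @ r"
      if "(f \<otimes>\<^bsub>?R\<^esub> g) (u, p) \<noteq> 0" for u p
    proof -
      from that obtain i where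
        "f (u, take i p) * g (path_target Q u (take i p), drop i p) \<noteq> 0"
        by (auto simp: d elim: sum.not_neutral_contains_not_neutral)
      then show ?thesis
        by (intro exI[of _ "take i p"] exI[of _ "drop i p"]) auto
    qed
    have "{p. (f \<otimes>\<^bsub>?R\<^esub> g) p \<noteq> 0} \<subseteq> (\<lambda>(x, y). (fst x, snd x @ snd y)) ` (?F \<times> ?G)"
    proof
      fix x assume "x \<in> {p. (f \<otimes>\<^bsub>?R\<^esub> g) p \<noteq> 0}"
      then obtain q r where "(fst x, q) \<in> ?F" "(path_target Q (fst x) q, r) \<in> ?G" "snd x = q @ r"
        using sub[of "fst x" "snd x"] by auto
      then show "x \<in> (\<lambda>(x, y). (fst x, snd x @ snd y)) ` (?F \<times> ?G)"
        by (intro image_eqI[of _ _ "((fst x, q), (path_target Q (fst x) q, r))"])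
          (auto simp: prod_eq_iff)
    qed
    moreover have "finite ?F" "finite ?G" using that by (auto simp: d)
    ultimately have 1: "finite {p. (f \<otimes>\<^bsub>?R\<^esub> g) p \<noteq> 0}"
      by (meson finite_SigmaI finite_imageI finite_subset)
    have FG: "?F \<subseteq> quiver_paths Q" "?G \<subseteq> quiver_paths Q" using that by (auto simp: d)
    have 2: "{p. (f \<otimes>\<^bsub>?R\<^esub> g) p \<noteq> 0} \<subseteq> quiver_paths Q"
    proof clarify
      fix u p assume "(f \<otimes>\<^bsub>?R\<^esub> g) (u, p) \<noteq> 0"
      then obtain q r where "(u, q) \<in> ?F" "(path_target Q u q, r) \<in> ?G" "p = q @ r"
        using sub by blast
      then show "(u, p) \<in> quiver_paths Q"
        using FG quiver_paths_append[OF wf] by blast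
    qed
    show ?thesis using 1 2 by (simp add: d)
  qed
  have assoc: "(f \<otimes>\<^bsub>?R\<^esub> g) \<otimes>\<^bsub>?R\<^esub> h = f \<otimes>\<^bsub>?R\<^esub> (g \<otimes>\<^bsub>?R\<^esub> h)" for f g h
  proof (rule ext, clarify)
    fix u and p :: "'e list"
    let ?t = "\<lambda>j k. f (u, take j p) * g (path_target Q u (take j p), take k (drop j p))
      * h (path_target Q u (take (j + k) p), drop (j + k) p)"
    have "((f \<otimes>\<^bsub>?R\<^esub> g) \<otimes>\<^bsub>?R\<^esub> h) (u, p) = (\<Sum>i\<le>length p. \<Sum>j\<le>i. ?t j (i - j))"
      unfolding mult_apply sum_distrib_right
      by (intro sum.cong) (auto simp: min_def drop_take)
    also have "\<dots> = (\<Sum>x\<in>(SIGMA i:{..length p}. {..i}). ?t (snd x) (fst x - snd x))"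
      by (simp add: sum.Sigma split_beta, rule sum.cong) auto
    also have "\<dots> = (\<Sum>x\<in>(SIGMA j:{..length p}. {..length p - j}). ?t (fst x) (snd x))"
      by (rule sum.reindex_bij_witness[of _ "\<lambda>(j, k). (j + k, j)" "\<lambda>(i, j). (j, i - j)"]) auto
    also have "\<dots> = (\<Sum>j\<le>length p. \<Sum>k\<le>length p - j. ?t j k)"
      by (simp add: sum.Sigma split_beta)
    also have "\<dots> = (f \<otimes>\<^bsub>?R\<^esub> (g \<otimes>\<^bsub>?R\<^esub> h)) (u, p)"
      unfolding mult_apply sum_distrib_left
      by (intro sum.cong) (simp_all add: path_target_take_add mult.assoc add.commute)
    finally show "((f \<otimes>\<^bsub>?R\<^esub> g) \<otimes>\<^bsub>?R\<^esub> h) (u, p) = (f \<otimes>\<^bsub>?R\<^esub> (g \<otimes>\<^bsub>?R\<^esub> h)) (u, p)" .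
  qed
  have one_closed: "\<one>\<^bsub>?R\<^esub> \<in> carrier ?R"
  proof -
    have "{x. \<one>\<^bsub>?R\<^esub> x \<noteq> 0} = verts Q \<times> {[]}" by (auto simp: d split: if_splits)
    moreover have "verts Q \<times> {[]} \<subseteq> quiver_paths Q"
      by (auto simp: quiver_paths_def pre_digraph.awalk_def pre_digraph.cas.simps)
    ultimately show ?thesis using fin by (simp add: d)
  qed
  have l_one: "\<one>\<^bsub>?R\<^esub> \<otimes>\<^bsub>?R\<^esub> f = f" if "f \<in> carrier ?R" for f
  proof (rule ext, clarify)
    fix u and p :: "'e list"
    have "(\<one>\<^bsub>?R\<^esub> \<otimes>\<^bsub>?R\<^esub> f) (u, p) = 
        (\<Sum>i\<le>length p. if i = 0 then if u \<in> verts Q then f (u, p) else 0 else 0)"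
      unfolding mult_apply by (rule sum.cong) (auto simp: d path_target_simps)
    also have "\<dots> = f (u, p)"
      using that quiver_paths_source[of u p Q] by (auto simp: d)
    finally show "(\<one>\<^bsub>?R\<^esub> \<otimes>\<^bsub>?R\<^esub> f) (u, p) = f (u, p)" .
  qed
  have r_one: "f \<otimes>\<^bsub>?R\<^esub> \<one>\<^bsub>?R\<^esub> = f" if "f \<in> carrier ?R" for f
  proof (rule ext, clarify)
    fix u and p :: "'e list"
    have "(f \<otimes>\<^bsub>?R\<^esub> \<one>\<^bsub>?R\<^esub>) (u, p) =
        (\<Sum>i\<le>length p. if i = length p then
          if path_target Q u p \<in> verts Q then f (u, p) else 0 else 0)"
      unfolding mult_apply by (rule sum.cong) (auto simp: d)
    also have "\<dots> = f (u, p)"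
      using that quiver_paths_target[OF wf, of u p] by (auto simp: d)
    finally show "(f \<otimes>\<^bsub>?R\<^esub> \<one>\<^bsub>?R\<^esub>) (u, p) = f (u, p)" .
  qed
  have add_closed: "f \<oplus>\<^bsub>?R\<^esub> g \<in> carrier ?R" if "f \<in> carrier ?R" "g \<in> carrier ?R" for f g
  proof -
    have "{p. f p + g p \<noteq> 0} \<subseteq> {p. f p \<noteq> 0} \<union> {p. g p \<noteq> 0}" by auto
    then show ?thesis using that by (auto simp: d intro: finite_subset)
  qed
  have add_apply: "(f \<oplus>\<^bsub>?R\<^esub> g) p = f p + g p" for f g p by (simp add: d)
  show ?thesis
  proof (rule ringI)
    show "abelian_group ?R"
    proof (rule abelian_groupI)
      fix f assume "f \<in> carrier ?R"
      then show "\<exists>g\<in>carrier ?R. g \<oplus>\<^bsub>?R\<^esub> f = \<zero>\<^bsub>?R\<^esub>"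
        by (intro bexI[of _ "\<lambda>p. - f p"]) (auto simp: d)
    next
      show "\<zero>\<^bsub>?R\<^esub> \<in> carrier ?R" by (simp add: d)
    next
      fix f show "\<zero>\<^bsub>?R\<^esub> \<oplus>\<^bsub>?R\<^esub> f = f" by (simp add: d)
    qed (use add_closed in \<open>auto simp: add_apply add_ac fun_eq_iff\<close>)
    show "monoid ?R"
      by (rule monoidI) (use mclosed assoc one_closed l_one r_one in auto)
  next
    fix f g h
    show "(f \<oplus>\<^bsub>?R\<^esub> g) \<otimes>\<^bsub>?R\<^esub> h = f \<otimes>\<^bsub>?R\<^esub> h \<oplus>\<^bsub>?R\<^esub> g \<otimes>\<^bsub>?R\<^esub> h"
      and "h \<otimes>\<^bsub>?R\<^esub> (f \<oplus>\<^bsub>?R\<^esub> g) = h \<otimes>\<^bsub>?R\<^esub> f \<oplus>\<^bsub>?R\<^esub> h \<otimes>\<^bsub>?R\<^esub> g"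
      by (auto simp: fun_eq_iff mult_apply add_apply distrib_left distrib_right sum.distrib)
  qed
qed

section \<open>Nakayama algebras\<close>

definition cyclic_succ :: "nat \<Rightarrow> nat \<Rightarrow> nat" where
  "cyclic_succ n a = (if a < n then a + 1 else 1)"

text \<open>The arrow \<open>x\<^sub>a\<close> is represented by its source \<open>a\<close>.\<close>

definition cyclic_quiver :: "nat \<Rightarrow> (nat, nat) pre_digraph" where
  "cyclic_quiver n =
    \<lparr> verts = {1..n}, arcs = {1..n}, tail = (\<lambda>a. a), head = cyclic_succ n \<rparr>"

lemma cyclic_quiver_fin_digraph: "fin_digraph (cyclic_quiver n)"
  by unfold_locales (auto simp: cyclic_quiver_def cyclic_succ_def)

locale algebra_over_field = ring A
  for A :: "('a, 'm) ring_scheme" (structure) and scalar :: "'k::field \<Rightarrow> 'a" +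
  assumes scalar_closed: "scalar c \<in> carrier A"
    and scalar_one: "scalar 1 = \<one>"
    and scalar_add: "scalar (c + d) = scalar c \<oplus> scalar d"
    and scalar_mult: "scalar (c * d) = scalar c \<otimes> scalar d"
    and scalar_central: "x \<in> carrier A \<Longrightarrow> scalar c \<otimes> x = x \<otimes> scalar c"

text \<open>
  The isomorphism \<open>\<phi>\<close> from the quotient of the path algebra by the ideal generated by the paths in
  \<open>\<rho>\<close> is part of the data, because the vertices and the length grading of \<open>A\<close> refer to it.
\<close>

locale nakayama_algebra = algebra_over_field A scalar
  for n :: nat and \<rho> :: "(nat \<times> nat list) set"
    and A :: "('a, 'm) ring_scheme" (structure) and scalar :: "'k::field \<Rightarrow> 'a"
    and \<phi> :: "(nat \<times> nat list \<Rightarrow> 'k) set \<Rightarrow> 'a" +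
  assumes order_pos: "n \<ge> 1"
    and finite_relations: "finite \<rho>"
    and relations_nontrivial_paths: "\<rho> \<subseteq> {(u, p) \<in> quiver_paths (cyclic_quiver n). p \<noteq> []}"
    and iso: "\<phi> \<in> ring_iso
      (path_algebra (cyclic_quiver n)
        Quot Idl\<^bsub>path_algebra (cyclic_quiver n)\<^esub> (single_path ` \<rho>)) A"
    and iso_scalar:
      "\<phi> (Idl\<^bsub>path_algebra (cyclic_quiver n)\<^esub> (single_path ` \<rho>)
          +>\<^bsub>path_algebra (cyclic_quiver n)\<^esub> path_algebra_scalar (cyclic_quiver n) c) = scalar c"
    and finite_dimensional: "finite_dimension (range scalar) (carrier A)"
begin

definition residue :: "(nat \<times> nat list \<Rightarrow> 'k) \<Rightarrow> 'a" where
  "residue f = \<phi> (Idl\<^bsub>path_algebra (cyclic_quiver n)\<^esub> (single_path ` \<rho>)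
    +>\<^bsub>path_algebra (cyclic_quiver n)\<^esub> f)"

definition idempotent :: "nat \<Rightarrow> 'a" where
  "idempotent a = residue (single_path (a, []))"

definition projective :: "nat \<Rightarrow> 'a set" where
  "projective a = {idempotent a \<otimes> x |x. x \<in> carrier A}"

text \<open>
  Dimensions over \<open>k\<close> are dimensions over the image of \<open>k\<close> in \<open>A\<close>, which is a central subfield.
\<close>

definition dim_projective :: "nat \<Rightarrow> nat" where
  "dim_projective a = dim (range scalar) (projective a)"

definition degree_part :: "nat \<Rightarrow> 'a set" where
  "degree_part l = residue ` path_algebra_degree (cyclic_quiver n) l"

definition graded_cartan :: "nat \<Rightarrow> nat \<Rightarrow> rat poly" where
  "graded_cartan a b = Sum_any (\<lambda>l. Polynomial.monom (of_nat
    (dim (range scalar) {idempotent b \<otimes> x \<otimes> idempotent a |x. x \<in> degree_part l})) l)"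

definition resolution_quiver :: "(nat, nat) pre_digraph" where
  "resolution_quiver =
    \<lparr> verts = {1..n}, arcs = {1..n}, tail = (\<lambda>a. a),
      head = (\<lambda>a. (cyclic_succ n ^^ dim_projective a) a) \<rparr>"

definition cycle_weight :: "nat list \<Rightarrow> rat" where
  "cycle_weight C = (\<Sum>a\<in>tail resolution_quiver ` set C. of_nat (dim_projective a)) / of_nat n"

end

definition cyclic_vertex :: "('v, 'e) pre_digraph \<Rightarrow> 'v \<Rightarrow> bool" where
  "cyclic_vertex G a \<longleftrightarrow> (\<exists>C. pre_digraph.cycle G C \<and> a \<in> tail G ` set C)"

definition component_verts :: "('v, 'e) pre_digraph \<Rightarrow> 'v \<Rightarrow> 'v set" where
  "component_verts G a = {b. a \<rightarrow>\<^sup>*\<^bsub>with_proj (mk_symmetric G)\<^esub> b}"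

section \<open>Weightings\<close>

definition is_weighting :: "nat \<Rightarrow> (nat \<Rightarrow> nat \<Rightarrow> 'a::semiring_1) \<Rightarrow> (nat \<Rightarrow> 'a) \<Rightarrow> bool" where
  "is_weighting n C \<alpha> \<longleftrightarrow> (\<forall>a\<in>{1..n}. (\<Sum>b\<in>{1..n}. C a b * \<alpha> b) = 1)"

text \<open>
  The rational function \<open>f\<close> is defined at \<open>x\<close> and has the value \<open>v\<close> there.
\<close>

definition has_value_at :: "'a::field poly fract \<Rightarrow> 'a \<Rightarrow> 'a \<Rightarrow> bool" where
  "has_value_at f x v \<longleftrightarrow> (\<exists>p q. f = Fract p q \<and> poly q x \<noteq> 0 \<and> v = poly p x / poly q x)"

end

theory Submission
  imports Defs
begin

text \<open>
  Multiplying the weighting equation by \<open>1 - t N\<close>, where \<open>N\<close> is the permutation matrix of \<open>\<tau>\<close>, makes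
  the columns of the Cartan matrix telescope and leaves the recursion
  \<open>\<alpha>\<^sub>c = (1 - t) + (\<Sum>\<gamma>(b) = c. t\<^bsup>p(b)\<^esup> \<alpha>\<^sub>b)\<close>
  over the predecessors of \<open>c\<close> in the resolution quiver. Unwinding it along the tree attached to a
  noncyclic \<open>c\<close> shows that \<open>\<alpha>\<^sub>c\<close> is divisible by \<open>1 - t\<close>, with the size of the tree as the value of the
  quotient at \<open>1\<close>. Unwinding it once around a cycle of total length \<open>W\<close> gives
  \<open>(1 - t\<^bsup>W\<^esup>) \<alpha>\<^sub>c = (1 - t) \<delta>\<close>, where \<open>\<delta>(1)\<close> is the size of the component, so
  \<open>\<alpha>\<^sub>c(1) = \<delta>(1) / W\<close>. Finally \<open>W\<close> is the same for all cycles: since \<open>p(a) \<le> p(\<tau>(a)) + 1\<close>, the map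
  \<open>k \<mapsto> k + p(k mod n)\<close> is a lift of a monotone circle map of degree one, all of whose periodic
  orbits have the same period and the same rotation number.
\<close>

section \<open>Iterating a map on a finite set\<close>

lemma funpow_mem: "f ` V \<subseteq> V \<Longrightarrow> x \<in> V \<Longrightarrow> (f ^^ k) x \<in> V"
  by (induction k) auto

lemma funpow_pred_apply: "d > 0 \<Longrightarrow> (f ^^ d) x = (f ^^ (d - 1)) (f x)"
  by (cases d) (simp_all add: funpow_swap1)

lemma funpow_diff_apply: "j \<le> k \<Longrightarrow> (f ^^ k) x = (f ^^ (k - j)) ((f ^^ j) x)"
  using funpow_add[of "k - j" j f] by simp

lemma funpow_orbitI: "(f ^^ k) x = y \<Longrightarrow> 0 < k \<Longrightarrow> y \<in> orbit f x"
  unfolding orbit_altdef by blast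

text \<open>The tree hanging at \<open>c\<close>: points that reach \<open>c\<close> without meeting
  a periodic point strictly earlier. An \<open>orbit\<close> contains only positive iterates, so
  \<open>x \<in> orbit f x\<close> means that \<open>x\<close> is periodic. For periodic
  \<open>c\<close> the condition cuts off the rest of its cycle.\<close>

definition branch :: "'v set \<Rightarrow> ('v \<Rightarrow> 'v) \<Rightarrow> 'v \<Rightarrow> 'v set" where
  "branch V f c = {b \<in> V. \<exists>k. (f ^^ k) b = c \<and> (\<forall>i<k. (f ^^ i) b \<notin> orbit f ((f ^^ i) b))}"

lemma finite_branch: "finite V \<Longrightarrow> finite (branch V f c)"
  by (simp add: branch_def)

lemma branch_unfold:
  assumes "f ` V \<subseteq> V" "c \<in> V"
  shows "branch V f c = insert c (\<Union>b\<in>{b \<in> V. f b = c \<and> b \<notin> orbit f b}. branch V f b)"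
proof (intro equalityI subsetI)
  fix x assume "x \<in> branch V f c"
  then obtain k where x: "x \<in> V" "(f ^^ k) x = c" "\<forall>i<k. (f ^^ i) x \<notin> orbit f ((f ^^ i) x)"
    by (auto simp: branch_def)
  show "x \<in> insert c (\<Union>b\<in>{b \<in> V. f b = c \<and> b \<notin> orbit f b}. branch V f b)"
  proof (cases k)
    case (Suc j)
    then have "x \<in> branch V f ((f ^^ j) x)" "(f ^^ j) x \<in> V" "f ((f ^^ j) x) = c"
      "(f ^^ j) x \<notin> orbit f ((f ^^ j) x)"
      using x funpow_mem[OF assms(1) x(1)] unfolding branch_def by fastforce+
    then show ?thesis by blast
  qed (use x in simp)
next
  fix x assume "x \<in> insert c (\<Union>b\<in>{b \<in> V. f b = c \<and> b \<notin> orbit f b}. branch V f b)"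
  then consider "x = c" | b where "b \<in> V" "f b = c" "b \<notin> orbit f b" "x \<in> branch V f b" by blast
  then show "x \<in> branch V f c"
  proof cases
    case 1
    then show ?thesis using assms(2) by (auto simp: branch_def intro!: exI[of _ 0])
  next
    case 2
    then obtain k where "x \<in> V" "(f ^^ k) x = b" "\<forall>i<k. (f ^^ i) x \<notin> orbit f ((f ^^ i) x)"
      by (auto simp: branch_def)
    with 2 show ?thesis by (auto simp: branch_def less_Suc_eq intro!: exI[of _ "Suc k"])
  qed
qed

text \<open>A path from \<open>c\<close> back to its preimage \<open>b\<close> would close a cycle
  through \<open>b\<close>.\<close>

lemma notin_branch_pred:
  assumes "f b = c" "b \<notin> orbit f b"
  shows "c \<notin> branch V f b"
proof
  assume "c \<in> branch V f b"
  with assms obtain k where "(f ^^ k) (f b) = b" by (auto simp: branch_def)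
  then have "(f ^^ Suc k) b = b" by (simp only: funpow_Suc_right comp_apply)
  then show False using assms(2) funpow_orbitI[of "Suc k" f] by blast
qed

text \<open>At time \<open>k\<close> the path is at \<open>b\<close>, and \<open>l - k\<close>
  further steps lead to \<open>b'\<close>. The first of them lands at \<open>f b = f b'\<close>, so
  the same number of steps takes \<open>b'\<close> back to itself.\<close>

lemma funpow_pred_eq:
  assumes "f b = f b'" "(f ^^ k) x = b" "(f ^^ l) x = b'" "k < l"
  shows "b' \<in> orbit f b'"
proof -
  have "(f ^^ (l - k)) b = b'" using funpow_diff_apply[of k l f x] assms by simp
  then have "(f ^^ (l - k)) b' = b'"
    using assms(1,4) by (simp add: funpow_pred_apply)
  then show ?thesis using assms(4) funpow_orbitI[of "l - k" f b' b'] by simp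
qed

lemma branch_pred_disjoint:
  assumes "f b = f b'" "b \<notin> orbit f b" "b' \<notin> orbit f b'" "b \<noteq> b'"
  shows "branch V f b \<inter> branch V f b' = {}"
proof (rule ccontr)
  assume "\<not> ?thesis"
  then obtain x k l where "(f ^^ k) x = b" "(f ^^ l) x = b'"
    by (auto simp: branch_def)
  then show False
    using funpow_pred_eq[of f b b' k x l] funpow_pred_eq[of f b' b l x k] assms
    by (metis linorder_neqE_nat)
qed

text \<open>Both \<open>c\<close> and \<open>c'\<close> would be the first periodic point on the
  forward path of a common member.\<close>

lemma branch_periodic_disjoint:
  assumes "c \<in> orbit f c" "c' \<in> orbit f c'" "c \<noteq> c'"
  shows "branch V f c \<inter> branch V f c' = {}"
proof (rule ccontr)
  assume "\<not> ?thesis"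
  then obtain x k l where "(f ^^ k) x = c" "\<forall>i<k. (f ^^ i) x \<notin> orbit f ((f ^^ i) x)"
    "(f ^^ l) x = c'" "\<forall>i<l. (f ^^ i) x \<notin> orbit f ((f ^^ i) x)"
    by (auto simp: branch_def)
  then show False using assms by (metis linorder_neqE_nat)
qed

lemma card_branch:
  assumes "finite V" "f ` V \<subseteq> V" "c \<in> V"
  shows "card (branch V f c) = Suc (\<Sum>b | b \<in> V \<and> f b = c \<and> b \<notin> orbit f b. card (branch V f b))"
proof -
  have "card (branch V f c) = Suc (card (\<Union>b\<in>{b \<in> V. f b = c \<and> b \<notin> orbit f b}. branch V f b))"
    unfolding branch_unfold[OF assms(2,3)] using assms(1)
    by (subst card_insert_disjoint) (auto simp: finite_branch dest!: notin_branch_pred[OF refl])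
  also have "card (\<Union>b\<in>{b \<in> V. f b = c \<and> b \<notin> orbit f b}. branch V f b) =
      (\<Sum>b | b \<in> V \<and> f b = c \<and> b \<notin> orbit f b. card (branch V f b))"
    using assms(1) by (intro card_UN_disjoint) (auto simp: finite_branch branch_pred_disjoint)
  finally show ?thesis .
qed

text \<open>The branch point is the first periodic iterate of \<open>b\<close>. A path starting at a
  periodic point never leaves its cycle, so this iterate already lies on the cycle met at time
  \<open>k\<close>.\<close>

lemma mem_branch_first_periodic:
  assumes "finite V" "b \<in> V" "(f ^^ k) b \<in> orbit f c" "c \<in> orbit f c"
  shows "\<exists>y\<in>orbit f c. b \<in> branch V f y"
proof -
  have per: "(f ^^ k) b \<in> orbit f ((f ^^ k) b)"
    using assms(3,4) by (rule self_in_orbit_trans[rotated])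
  define l where "l = (LEAST l. (f ^^ l) b \<in> orbit f ((f ^^ l) b))"
  have l: "(f ^^ l) b \<in> orbit f ((f ^^ l) b)" "l \<le> k"
    unfolding l_def using per by (auto intro: LeastI Least_le)
  have "(f ^^ l) b \<in> orbit f ((f ^^ k) b)"
  proof (cases "l = k")
    case False
    have "(f ^^ k) b \<in> orbit f ((f ^^ l) b)"
      using funpow_diff_apply[OF l(2), of f b] False l(2) by (intro funpow_orbitI[of "k - l" f]) simp_all
    then show ?thesis using l(1) by (rule orbit_swap[rotated])
  qed (use per in simp)
  then have "(f ^^ l) b \<in> orbit f c"
    using assms(3) orbit_trans by fastforce
  moreover have "b \<in> branch V f ((f ^^ l) b)"
    using assms(2) not_less_Least[of _ "\<lambda>l. (f ^^ l) b \<in> orbit f ((f ^^ l) b)"]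
    by (auto simp: branch_def l_def)
  ultimately show ?thesis by blast
qed

text \<open>Converts tree sizes into the size of a component: every point that flows into the cycle
  belongs to the branch of exactly one cycle point.\<close>

lemma card_basin:
  assumes "finite V" "f ` V \<subseteq> V" "c \<in> V" "c \<in> orbit f c"
  shows "card {b \<in> V. \<exists>k. (f ^^ k) b \<in> orbit f c} = (\<Sum>y\<in>orbit f c. card (branch V f y))"
proof -
  have "{b \<in> V. \<exists>k. (f ^^ k) b \<in> orbit f c} = (\<Union>y\<in>orbit f c. branch V f y)"
    using mem_branch_first_periodic[OF assms(1) _ _ assms(4)] by (auto simp: branch_def)
  also have "card \<dots> = (\<Sum>y\<in>orbit f c. card (branch V f y))"
    using assms by (intro card_UN_disjoint)
      (simp_all add: finite_branch finite_orbit branch_periodic_disjoint self_in_orbit_trans)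
  finally show ?thesis .
qed

lemma orbit_enum:
  assumes "x \<in> orbit f x"
  obtains m where "m > 0" "(f ^^ m) x = x" "orbit f x = (\<lambda>i. (f ^^ i) x) ` {..<m}"
    "inj_on (\<lambda>i. (f ^^ i) x) {..<m}"
proof -
  let ?m = "funpow_dist1 f x x"
  have 1: "(f ^^ ?m) x = x" using assms by (rule funpow_dist1_prop)
  show ?thesis
  proof (rule that[of ?m])
    show "orbit f x = (\<lambda>i. (f ^^ i) x) ` {..<?m}"
      using orbit_altdef_bounded[OF 1] by auto
    show "inj_on (\<lambda>i. (f ^^ i) x) {..<?m}"
      using inj_on_funpow_dist1[OF assms] by (simp add: lessThan_atLeast0)
  qed (use 1 in simp_all)
qed

text \<open>After the common multiple \<open>k * l\<close> of the two periods both points have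
  returned, and a positive iterate depends only on the common image.\<close>

lemma periodic_pred_unique:
  assumes "b \<in> orbit f b" "b' \<in> orbit f b'" "f b = f b'"
  shows "b = b'"
proof -
  obtain k l where "(f ^^ k) b = b" "k > 0" "(f ^^ l) b' = b'" "l > 0"
    using assms(1,2) by (auto simp: orbit_altdef) metis
  then have "(f ^^ (k * l)) b = b" "(f ^^ (k * l)) b' = b'" "k * l > 0"
    using funpow_mod_eq[of k f b "k * l"] funpow_mod_eq[of l f b' "k * l"] by simp_all
  then show ?thesis using assms(3) by (metis funpow_pred_apply)
qed

section \<open>Values of rational functions at a point\<close>

lemma has_value_at_Fract: "poly q x \<noteq> 0 \<Longrightarrow> has_value_at (Fract p q) x (poly p x / poly q x)"
  by (auto simp: has_value_at_def)

lemma has_value_at_poly: "has_value_at (Fract p 1) x (poly p x)"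
  using has_value_at_Fract[of 1 x p] by simp

lemma has_value_at_0: "has_value_at 0 x 0"
  using has_value_at_poly[of 0 x] by (simp add: Zero_fract_def)

lemma has_value_at_1: "has_value_at 1 x 1"
  using has_value_at_poly[of 1 x] by (simp add: One_fract_def)

lemma has_value_at_add:
  assumes "has_value_at f x u" "has_value_at g x v"
  shows "has_value_at (f + g) x (u + v)"
proof -
  obtain p q r s where "f = Fract p q" "poly q x \<noteq> 0" "u = poly p x / poly q x"
    "g = Fract r s" "poly s x \<noteq> 0" "v = poly r x / poly s x"
    using assms unfolding has_value_at_def by blast
  moreover from this have "q \<noteq> 0" "s \<noteq> 0" by auto
  ultimately show ?thesis
    using has_value_at_Fract[of "q * s" x "p * s + r * q"] by (simp add: add_frac_eq)
qed

lemma has_value_at_mult: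
  assumes "has_value_at f x u" "has_value_at g x v"
  shows "has_value_at (f * g) x (u * v)"
proof -
  obtain p q r s where "f = Fract p q" "poly q x \<noteq> 0" "u = poly p x / poly q x"
    "g = Fract r s" "poly s x \<noteq> 0" "v = poly r x / poly s x"
    using assms unfolding has_value_at_def by blast
  then show ?thesis
    using has_value_at_Fract[of "q * s" x "p * r"] by simp
qed

lemma has_value_at_inverse:
  assumes "has_value_at f x u" "u \<noteq> 0"
  shows "has_value_at (inverse f) x (inverse u)"
proof -
  obtain p q where "f = Fract p q" "poly q x \<noteq> 0" "u = poly p x / poly q x"
    using assms unfolding has_value_at_def by blast
  then show ?thesis
    using has_value_at_Fract[of p x q] assms(2) by simp
qed

lemma has_value_at_divide:
  "has_value_at f x u \<Longrightarrow> has_value_at g x v \<Longrightarrow> v \<noteq> 0 \<Longrightarrow> has_value_at (f / g) x (u / v)"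
  unfolding divide_inverse by (intro has_value_at_mult has_value_at_inverse)

lemma has_value_at_sum:
  "(\<And>i. i \<in> S \<Longrightarrow> has_value_at (f i) x (u i)) \<Longrightarrow> has_value_at (\<Sum>i\<in>S. f i) x (\<Sum>i\<in>S. u i)"
  by (induction S rule: infinite_finite_induct) (simp_all add: has_value_at_0 has_value_at_add)

lemma has_value_at_power: "has_value_at f x u \<Longrightarrow> has_value_at (f ^ k) x (u ^ k)"
  by (induction k) (simp_all add: has_value_at_1 has_value_at_mult)

text \<open>In contrapositive form, a fraction with a nonzero value is nonzero; this permits
  dividing by the geometric sum in \<open>weighting_periodic\<close>.\<close>

lemma has_value_at_0_unique: "has_value_at 0 x u \<Longrightarrow> u = 0"
proof -
  assume "has_value_at 0 x u"
  then obtain p q where "Fract 0 1 = Fract p q" "poly q x \<noteq> 0" "u = poly p x / poly q x"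
    unfolding has_value_at_def Zero_fract_def by blast
  moreover from this(2) have "q \<noteq> 0" by auto
  ultimately show ?thesis by (simp add: eq_fract)
qed

text \<open>The indeterminate \<open>t\<close> of the function field.\<close>

abbreviation fract_X :: "'a::field poly fract" where
  "fract_X \<equiv> Fract [:0, 1:] 1"

lemma has_value_at_X_power: "has_value_at (fract_X ^ k) 1 1"
  using has_value_at_power[OF has_value_at_poly[of "[:0, 1:]" 1]] by simp

lemma fract_X_neq_1: "1 - fract_X \<noteq> (0 :: 'a::field poly fract)"
  by (simp add: One_fract_def Zero_fract_def eq_fract one_pCons)

lemma has_value_at_vanishing:
  assumes "has_value_at \<beta> 1 u"
  shows "has_value_at ((1 - fract_X) * \<beta>) 1 0"
proof -
  have "has_value_at (Fract [:1, -1:] 1) (1::'a) 0"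
    using has_value_at_poly[of "[:1, -1::'a:]" 1] by simp
  moreover have "Fract [:1, -1:] 1 = 1 - (fract_X :: 'a poly fract)"
    by (simp add: One_fract_def one_pCons)
  ultimately have "has_value_at (1 - fract_X) (1::'a) 0" by simp
  from has_value_at_mult[OF this assms] show ?thesis by simp
qed

section \<open>Solving the recursion\<close>

text \<open>
  Solving the recursion backwards through the tree that hangs at \<open>c\<close> splits off a factor \<open>1 - t\<close>
  from everything but the contribution of the periodic predecessor of \<open>c\<close>.
\<close>

lemma recursion_branch:
  fixes \<alpha> :: "'v \<Rightarrow> 'k::field poly fract"
  assumes "finite V" "f ` V \<subseteq> V"
    and rec: "\<And>c. c \<in> V \<Longrightarrow> \<alpha> c = (1 - fract_X) + (\<Sum>b | b \<in> V \<and> f b = c. fract_X ^ p b * \<alpha> b)"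
    and "c \<in> V"
  shows "\<exists>\<beta>. has_value_at \<beta> 1 (of_nat (card (branch V f c))) \<and>
    \<alpha> c = (1 - fract_X) * \<beta> + (\<Sum>b | b \<in> V \<and> f b = c \<and> b \<in> orbit f b. fract_X ^ p b * \<alpha> b)"
  using \<open>c \<in> V\<close>
proof (induction "card (branch V f c)" arbitrary: c rule: less_induct)
  case less
  let ?N = "{b. b \<in> V \<and> f b = c \<and> b \<notin> orbit f b}" and ?P = "{b. b \<in> V \<and> f b = c \<and> b \<in> orbit f b}"
  have "\<exists>\<beta>. has_value_at \<beta> 1 (of_nat (card (branch V f b))) \<and> \<alpha> b = (1 - fract_X) * \<beta>"
    if "b \<in> ?N" for b
  proof -
    \<comment> \<open>The vertex \<open>c\<close> is missing from the branch of \<open>b\<close>, so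
      the induction on tree size reaches \<open>b\<close>.\<close>
    have "branch V f b \<subset> branch V f c"
      using that notin_branch_pred[of f b c V] branch_unfold[OF assms(2) less.prems] by blast
    then have lt: "card (branch V f b) < card (branch V f c)"
      using assms(1) by (simp add: psubset_card_mono finite_branch)
    from that have "b \<in> V" by simp
    from less.hyps[OF lt this] obtain \<beta> where val: "has_value_at \<beta> 1 (of_nat (card (branch V f b)))"
      and eq: "\<alpha> b = (1 - fract_X) * \<beta> + (\<Sum>b' | b' \<in> V \<and> f b' = b \<and> b' \<in> orbit f b'. fract_X ^ p b' * \<alpha> b')"
      by (elim exE conjE)
    \<comment> \<open>A periodic predecessor would make \<open>b\<close> periodic. Hence the
      leftover sum in the hypothesis for \<open>b\<close> vanishes and all of
      \<open>\<alpha> b\<close> carries the factor \<open>1 - t\<close>.\<close>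
    have empty: "{b'. b' \<in> V \<and> f b' = b \<and> b' \<in> orbit f b'} = {}"
      using that by (auto dest: orbit_sim_step)
    show ?thesis
      using val eq unfolding empty by auto
  qed
  then have "\<forall>b\<in>?N. \<exists>\<beta>. has_value_at \<beta> 1 (of_nat (card (branch V f b))) \<and> \<alpha> b = (1 - fract_X) * \<beta>"
    by blast
  from bchoice[OF this] obtain \<beta> where
    \<beta>: "\<And>b. b \<in> ?N \<Longrightarrow> has_value_at (\<beta> b) 1 (of_nat (card (branch V f b)))"
    "\<And>b. b \<in> ?N \<Longrightarrow> \<alpha> b = (1 - fract_X) * \<beta> b"
    by blast
  \<comment> \<open>The summand 1 stands for \<open>c\<close> itself. Each \<open>t ^ p b\<close>
    has value 1 at 1, so the value of \<open>\<delta>\<close> there is the size of the tree at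
    \<open>c\<close>.\<close>
  define \<delta> where "\<delta> = 1 + (\<Sum>b\<in>?N. fract_X ^ p b * \<beta> b)"
  have "has_value_at \<delta> 1 (1 + (\<Sum>b\<in>?N. 1 * of_nat (card (branch V f b))))"
    unfolding \<delta>_def
    by (intro has_value_at_add has_value_at_1 has_value_at_sum has_value_at_mult has_value_at_X_power \<beta>)
  also have "1 + (\<Sum>b\<in>?N. 1 * of_nat (card (branch V f b))) = (of_nat (card (branch V f c)) :: 'k)"
    by (simp add: card_branch[OF assms(1,2) less.prems])
  finally have val: "has_value_at \<delta> 1 (of_nat (card (branch V f c)))" .
  have "(\<Sum>b | b \<in> V \<and> f b = c. fract_X ^ p b * \<alpha> b) =
      (\<Sum>b\<in>?N. fract_X ^ p b * \<alpha> b) + (\<Sum>b\<in>?P. fract_X ^ p b * \<alpha> b)"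
    using assms(1) by (subst sum.union_disjoint[symmetric]) (auto intro!: sum.cong)
  also have "(\<Sum>b\<in>?N. fract_X ^ p b * \<alpha> b) = (1 - fract_X) * (\<Sum>b\<in>?N. fract_X ^ p b * \<beta> b)"
    by (simp add: \<beta>(2) sum_distrib_left mult.left_commute)
  finally have "\<alpha> c = (1 - fract_X) * \<delta> + (\<Sum>b\<in>?P. fract_X ^ p b * \<alpha> b)"
    using rec[OF less.prems] by (simp add: \<delta>_def distrib_left)
  with val show ?case by blast
qed

text \<open>A non-periodic vertex has no periodic predecessor, so only the multiple of
  \<open>1 - t\<close> remains, with a cofactor defined at 1.\<close>

lemma weighting_nonperiodic:
  fixes \<alpha> :: "'v \<Rightarrow> 'k::field poly fract"
  assumes "finite V" "f ` V \<subseteq> V"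
    and "\<And>c. c \<in> V \<Longrightarrow> \<alpha> c = (1 - fract_X) + (\<Sum>b | b \<in> V \<and> f b = c. fract_X ^ p b * \<alpha> b)"
    and "c \<in> V" "c \<notin> orbit f c"
  shows "has_value_at (\<alpha> c) 1 0"
proof -
  have empty: "{b. b \<in> V \<and> f b = c \<and> b \<in> orbit f b} = {}"
    using assms(5) by (auto dest: orbit_sim_step)
  obtain \<beta> where val: "has_value_at \<beta> 1 (of_nat (card (branch V f c)))"
    and eq: "\<alpha> c = (1 - fract_X) * \<beta> + (\<Sum>b | b \<in> V \<and> f b = c \<and> b \<in> orbit f b. fract_X ^ p b * \<alpha> b)"
    using recursion_branch[OF assms(1-4)] by blast
  show ?thesis
    using has_value_at_vanishing[OF val] eq unfolding empty by simp
qed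

text \<open>After one turn the recursion reproduces \<open>\<alpha> c\<close> with the factor
  \<open>t ^ W\<close>. Cancelling \<open>1 - t\<close> from \<open>1 - t ^ W\<close> leaves a
  geometric sum whose value at 1 is \<open>W\<close>, nonzero in characteristic 0.\<close>

lemma weighting_periodic:
  fixes \<alpha> :: "'v \<Rightarrow> 'k::field_char_0 poly fract"
  assumes "finite V" "f ` V \<subseteq> V"
    and rec: "\<And>c. c \<in> V \<Longrightarrow> \<alpha> c = (1 - fract_X) + (\<Sum>b | b \<in> V \<and> f b = c. fract_X ^ p b * \<alpha> b)"
    and "c \<in> V" "c \<in> orbit f c" and W: "(\<Sum>y\<in>orbit f c. p y) > 0"
  shows "has_value_at (\<alpha> c) 1 (of_nat (card {b \<in> V. \<exists>k. (f ^^ k) b \<in> orbit f c}) /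
    of_nat (\<Sum>y\<in>orbit f c. p y))"
proof -
  obtain m where m: "m > 0" "(f ^^ m) c = c" "orbit f c = (\<lambda>i. (f ^^ i) c) ` {..<m}"
    "inj_on (\<lambda>i. (f ^^ i) c) {..<m}"
    using orbit_enum[OF assms(5)] .
  have mem: "(f ^^ i) c \<in> V" "(f ^^ i) c \<in> orbit f ((f ^^ i) c)" for i
    using funpow_mem[OF assms(2,4)] funpow_in_orbit[OF assms(5)] self_in_orbit_trans[OF assms(5)]
    by auto
  have "\<forall>c\<in>V. \<exists>\<beta>. has_value_at \<beta> 1 (of_nat (card (branch V f c))) \<and> \<alpha> c = (1 - fract_X) * \<beta> +
      (\<Sum>b | b \<in> V \<and> f b = c \<and> b \<in> orbit f b. fract_X ^ p b * \<alpha> b)"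
    using recursion_branch[OF assms(1,2) rec] by blast
  from bchoice[OF this] obtain \<beta> where val: "\<And>c. c \<in> V \<Longrightarrow> has_value_at (\<beta> c) 1 (of_nat (card (branch V f c)))"
    and \<beta>: "\<And>c. c \<in> V \<Longrightarrow> \<alpha> c = (1 - fract_X) * \<beta> c +
      (\<Sum>b | b \<in> V \<and> f b = c \<and> b \<in> orbit f b. fract_X ^ p b * \<alpha> b)"
    by blast
  \<comment> \<open>The sum over periodic predecessors has a single term, the previous point of the
    cycle.\<close>
  have step: "\<alpha> ((f ^^ Suc i) c) = (1 - fract_X) * \<beta> ((f ^^ Suc i) c) +
      fract_X ^ p ((f ^^ i) c) * \<alpha> ((f ^^ i) c)" for i
  proof -
    have "{b. b \<in> V \<and> f b = (f ^^ Suc i) c \<and> b \<in> orbit f b} = {(f ^^ i) c}"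
      using mem[of i] periodic_pred_unique by fastforce
    then show ?thesis using \<beta>[OF mem(1)[of "Suc i"]] by simp
  qed
  \<comment> \<open>Going along the cycle, \<open>\<delta>\<close> collects the trees at the points
    with index 1 to \<open>k\<close>; the starting point enters only through
    \<open>\<alpha> c\<close>.\<close>
  have "\<exists>\<delta>. has_value_at \<delta> 1 (of_nat (\<Sum>i<k. card (branch V f ((f ^^ Suc i) c)))) \<and>
      \<alpha> ((f ^^ k) c) = (1 - fract_X) * \<delta> + fract_X ^ (\<Sum>i<k. p ((f ^^ i) c)) * \<alpha> c" for k
  proof (induction k)
    case 0
    show ?case by (auto intro: exI[of _ 0] has_value_at_0)
  next
    case (Suc k)
    then obtain \<delta> where \<delta>: "has_value_at \<delta> 1 (of_nat (\<Sum>i<k. card (branch V f ((f ^^ Suc i) c))))"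
      "\<alpha> ((f ^^ k) c) = (1 - fract_X) * \<delta> + fract_X ^ (\<Sum>i<k. p ((f ^^ i) c)) * \<alpha> c"
      by blast
    let ?d = "fract_X ^ p ((f ^^ k) c) * \<delta> + \<beta> ((f ^^ Suc k) c)"
    have "has_value_at ?d 1
        (1 * of_nat (\<Sum>i<k. card (branch V f ((f ^^ Suc i) c))) + of_nat (card (branch V f ((f ^^ Suc k) c))))"
      by (intro has_value_at_add has_value_at_mult has_value_at_X_power \<delta>(1) val mem(1))
    then have "has_value_at ?d 1 (of_nat (\<Sum>i<Suc k. card (branch V f ((f ^^ Suc i) c))))"
      by simp
    moreover have "\<alpha> ((f ^^ Suc k) c) =
        (1 - fract_X) * ?d + fract_X ^ (\<Sum>i<Suc k. p ((f ^^ i) c)) * \<alpha> c"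
      unfolding step \<delta>(2) by (simp add: algebra_simps power_add)
    ultimately show ?case by blast
  qed
  from this[of m] obtain \<delta> where \<delta>: "has_value_at \<delta> 1 (of_nat (\<Sum>i<m. card (branch V f ((f ^^ Suc i) c))))"
      "\<alpha> c = (1 - fract_X) * \<delta> + fract_X ^ (\<Sum>i<m. p ((f ^^ i) c)) * \<alpha> c"
    using m(2) by auto
  have w: "(\<Sum>i<m. p ((f ^^ i) c)) = (\<Sum>y\<in>orbit f c. p y)"
    unfolding m(3) by (simp add: sum.reindex[OF m(4)])
  \<comment> \<open>Indices 1 to \<open>m\<close> and 0 to \<open>m - 1\<close> run over the same
    points since \<open>(f ^^ m) c = c\<close>.\<close>
  have "(\<Sum>i<m. card (branch V f ((f ^^ Suc i) c))) = (\<Sum>i<m. card (branch V f ((f ^^ i) c)))"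
  proof -
    have "(\<Sum>i<m. card (branch V f ((f ^^ Suc i) c))) + card (branch V f ((f ^^ 0) c)) =
        (\<Sum>i<Suc m. card (branch V f ((f ^^ i) c)))"
      by (subst sum.lessThan_Suc_shift) simp
    then show ?thesis using m(2) by simp
  qed
  also have "\<dots> = card {b \<in> V. \<exists>k. (f ^^ k) b \<in> orbit f c}"
    unfolding card_basin[OF assms(1,2,4,5)] unfolding m(3) by (simp add: sum.reindex[OF m(4)])
  finally have n: "(\<Sum>i<m. card (branch V f ((f ^^ Suc i) c))) = card {b \<in> V. \<exists>k. (f ^^ k) b \<in> orbit f c}" .
  let ?W = "\<Sum>y\<in>orbit f c. p y" and ?g = "\<Sum>i<(\<Sum>y\<in>orbit f c. p y). fract_X ^ i :: 'k poly fract"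
  have g: "has_value_at ?g 1 (of_nat ?W)"
    using has_value_at_sum[of "{..<?W}" "\<lambda>i. fract_X ^ i" "1::'k" "\<lambda>_. 1", OF has_value_at_X_power] by simp
  have "(1 - fract_X) * (\<alpha> c * ?g) = (1 - fract_X ^ ?W) * \<alpha> c"
    by (simp add: one_diff_power_eq mult_ac)
  also have "\<dots> = (1 - fract_X) * \<delta>" using \<delta>(2) unfolding w by (simp add: algebra_simps)
  finally have eq: "\<alpha> c * ?g = \<delta>" using fract_X_neq_1[where 'a='k] by simp
  have "?g \<noteq> 0"
    using g W has_value_at_0_unique by (metis of_nat_eq_0_iff less_numeral_extra(3))
  then have "\<alpha> c = \<delta> / ?g" using eq by (simp add: field_simps)
  moreover have "of_nat ?W \<noteq> (0 :: 'k)" using W by (simp del: of_nat_sum)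
  ultimately show ?thesis
    using has_value_at_divide[OF \<delta>(1) g] unfolding n by (simp del: of_nat_sum)
qed

section \<open>Monotone circle maps of degree one\<close>

lemma funpow_degree_one:
  assumes "\<And>k. F (k + n) = F k + (n::nat)"
  shows "(F ^^ i) (k + n * j) = (F ^^ i) k + n * j"
proof -
  have "F (k + n * j) = F k + n * j" for k
    by (induction j) (auto simp: assms simp flip: add.assoc, metis assms add.assoc add.commute)
  then show ?thesis by (induction i) simp_all
qed

lemma funpow_translation:
  assumes "\<And>k. F (k + n) = F k + (n::nat)" "(F ^^ m) x = x + n * w"
  shows "(F ^^ (m * i)) x = x + n * (i * w)"
proof (induction i)
  case (Suc i)
  have "(F ^^ (m * Suc i)) x = (F ^^ m) ((F ^^ (m * i)) x)"
    by (simp add: funpow_add)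
  also have "\<dots> = x + n * (Suc i * w)"
    unfolding Suc.IH funpow_degree_one[of F n, OF assms(1)] assms(2) by (simp add: algebra_simps)
  finally show ?case .
qed simp

text \<open>Monotonicity and degree one preserve the order of \<open>x\<close>, \<open>y\<close> and
  \<open>x + n\<close> under iteration. As both displacements are multiples of \<open>n\<close>, the
  resulting inequalities force them to agree.\<close>

lemma rotation_numbers_less_eq:
  fixes F :: "nat \<Rightarrow> nat"
  assumes "mono F" "\<And>k. F (k + n) = F k + n"
    and "(F ^^ k) x = x + n * a" "(F ^^ k) y = y + n * b" "x < y" "y < x + n"
  shows "a = b"
proof -
  have "(F ^^ k) x \<le> (F ^^ k) y" "(F ^^ k) y \<le> (F ^^ k) (x + n * 1)"
    using assms(5,6) by (simp_all add: funpow_mono assms(1))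
  then have "x + n * a \<le> y + n * b" "y + n * b \<le> x + n * a + n"
    using funpow_degree_one[of F n k x 1] assms(2-4) by simp_all
  then have "n * a < n * Suc b" "n * b < n * Suc a"
    using assms(5,6) by simp_all
  then show ?thesis unfolding mult_less_cancel1 by simp
qed

text \<open>
  Two periodic orbits have the same rotation number, so \<open>x\<close> is a periodic point of \<open>F\<^sup>l\<close> translated
  back by \<open>n v\<close>; the periodic points of a monotone map are fixed points.
\<close>

lemma monotone_degree_one_return:
  fixes F :: "nat \<Rightarrow> nat"
  assumes F: "mono F" "\<And>k. F (k + n) = F k + n"
    and x: "(F ^^ m) x = x + n * w" "m > 0" and y: "(F ^^ l) y = y + n * v"
    and "x < y + n" "y < x + n"
  shows "(F ^^ l) x = x + n * v"
proof -
  \<comment> \<open>At time \<open>l * m\<close> both points have completed whole returns, so their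
    displacements become comparable.\<close>
  have kx: "(F ^^ (l * m)) x = x + n * (l * w)"
    using funpow_translation[of F n, OF F(2) x(1), of l] by (simp only: mult.commute)
  have ky: "(F ^^ (l * m)) y = y + n * (m * v)"
    using funpow_translation[of F n, OF F(2) y, of m] .
  have lw: "l * w = m * v"
  proof (cases x y rule: linorder_cases)
    case less
    then show ?thesis using rotation_numbers_less_eq[OF F kx ky] assms(7) by simp
  next
    case equal
    then have "n * (l * w) = n * (m * v)" using kx ky by (metis add_left_imp_eq)
    moreover have "n > 0" using assms(7) equal by simp
    ultimately show ?thesis by simp
  next
    case greater
    then show ?thesis using rotation_numbers_less_eq[OF F ky kx] assms(6) by simp
  qed
  let ?G = "F ^^ l"
  \<comment> \<open>The total displacement after \<open>m\<close> rounds of \<open>?G\<close> is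
    that of \<open>m\<close> moves by \<open>n * v\<close>, so a deviation in the first round would
    have to be undone later.\<close>
  have Gm: "(?G ^^ m) x = x + n * (m * v)"
    using kx unfolding lw by (simp only: funpow_mult)
  have shift: "?G (x + n * j) = ?G x + n * j" for j
    by (rule funpow_degree_one[of F n, OF F(2)])
  have mono: "mono ?G" using F(1) by (simp add: mono_def funpow_mono)
  have step: "(?G ^^ Suc i) x = ?G ((?G ^^ i) x)" for i by simp
  show ?thesis
  proof (rule ccontr)
    assume "?G x \<noteq> x + n * v"
    then consider "?G x > x + n * v" | "?G x < x + n * v" by linarith
    then show False
    proof cases
      case 1
      \<comment> \<open>Monotonicity preserves the overshoot in every round, against
        \<open>Gm\<close> at round \<open>m\<close>; undershooting is excluded in the same
        way.\<close>
      have "(?G ^^ Suc i) x > x + n * (Suc i * v)" for i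
      proof (induction i)
        case (Suc i)
        have "x + n * (Suc (Suc i) * v) < ?G (x + n * (Suc i * v))"
          unfolding shift using 1 by (simp add: algebra_simps)
        also have "\<dots> \<le> ?G ((?G ^^ Suc i) x)"
          using Suc.IH by (intro monoD[OF mono]) simp
        finally show ?case unfolding step[of "Suc i"] .
      qed (use 1 in simp)
      from this[of "m - 1"] show False using x(2) Gm by simp
    next
      case 2
      have "(?G ^^ Suc i) x < x + n * (Suc i * v)" for i
      proof (induction i)
        case (Suc i)
        have "?G ((?G ^^ Suc i) x) \<le> ?G (x + n * (Suc i * v))"
          using Suc.IH by (intro monoD[OF mono]) simp
        also have "\<dots> < x + n * (Suc (Suc i) * v)"
          unfolding shift using 2 by (simp add: algebra_simps)
        finally show ?case unfolding step[of "Suc i"] .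
      qed (use 2 in simp)
      from this[of "m - 1"] show False using x(2) Gm by simp
    qed
  qed
qed

section \<open>The resolution map and its lift\<close>

lemma cyclic_succ_mem: "n \<ge> 1 \<Longrightarrow> a \<in> {1..n} \<Longrightarrow> cyclic_succ n a \<in> {1..n}"
  by (auto simp: cyclic_succ_def)

lemma funpow_cyclic_succ_mem: "n \<ge> 1 \<Longrightarrow> a \<in> {1..n} \<Longrightarrow> (cyclic_succ n ^^ k) a \<in> {1..n}"
  by (rule funpow_mem) (use cyclic_succ_mem in auto)

lemma inj_on_cyclic_succ: "inj_on (cyclic_succ n) {1..n}"
  by (auto simp: inj_on_def cyclic_succ_def split: if_splits)

text \<open>Counting steps from vertex \<open>n\<close>, which plays the residue 0, identifies
  vertices with residues modulo \<open>n\<close>.\<close>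

lemma funpow_cyclic_succ_order:
  assumes "n \<ge> 1"
  shows "(cyclic_succ n ^^ k) n = (if k mod n = 0 then n else k mod n)"
proof (induction k)
  case (Suc k)
  have "k mod n < n" using assms by simp
  then show ?case
    using Suc assms by (auto simp: cyclic_succ_def mod_Suc)
qed simp

text \<open>The combinatorial content of the algebra: \<open>p\<close> abstracts the dimensions
  \<open>p_a\<close>, and \<open>f\<close> is the map \<gamma> of the resolution quiver. The
  inequality is what makes the lift monotone.\<close>

locale resolution_map =
  fixes n :: nat and p :: "nat \<Rightarrow> nat" and f :: "nat \<Rightarrow> nat"
  assumes n: "n \<ge> 1"
    and p: "a \<in> {1..n} \<Longrightarrow> p a \<le> Suc (p (cyclic_succ n a))"
    and f: "f = (\<lambda>a. (cyclic_succ n ^^ p a) a)"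
begin

text \<open>The covering of the cycle by the natural numbers, based at \<open>n\<close> so that it
  is the identity on \<open>{1..n}\<close>.\<close>

definition vertex :: "nat \<Rightarrow> nat" where
  "vertex k = (cyclic_succ n ^^ k) n"

definition lift :: "nat \<Rightarrow> nat" where
  "lift k = k + p (vertex k)"

lemma vertex_mem: "vertex k \<in> {1..n}"
  unfolding vertex_def using n by (intro funpow_cyclic_succ_mem) auto

lemma vertex_id: "k \<in> {1..n} \<Longrightarrow> vertex k = k"
  unfolding vertex_def funpow_cyclic_succ_order[OF n] by (cases "k = n") auto

lemma vertex_add: "vertex (k + j) = (cyclic_succ n ^^ j) (vertex k)"
  unfolding vertex_def by (subst add.commute) (simp add: funpow_add)

lemma vertex_eq_iff: "vertex k = vertex l \<longleftrightarrow> k mod n = l mod n"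
proof -
  have "((if a = 0 then n else a) = (if b = 0 then n else b)) \<longleftrightarrow> a = b" if "a < n" "b < n" for a b
    using that by auto
  then show ?thesis
    unfolding vertex_def funpow_cyclic_succ_order[OF n] using n by simp
qed

lemma vertex_lift: "vertex (lift k) = f (vertex k)"
  by (simp add: lift_def vertex_add f)

lemma vertex_funpow_lift: "vertex ((lift ^^ i) k) = (f ^^ i) (vertex k)"
  by (induction i) (simp_all add: vertex_lift)

lemma funpow_lift: "(lift ^^ i) k = k + (\<Sum>j<i. p ((f ^^ j) (vertex k)))"
proof (induction i)
  case (Suc i)
  have "(lift ^^ Suc i) k = (lift ^^ i) k + p ((f ^^ i) (vertex k))"
    using lift_def[of "(lift ^^ i) k"] by (simp add: vertex_funpow_lift)
  then show ?case using Suc.IH by simp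
qed simp

lemma lift_degree_one: "lift (k + n) = lift k + n"
proof -
  have "vertex (k + n) = vertex k" by (simp add: vertex_eq_iff)
  then show ?thesis by (simp add: lift_def)
qed

text \<open>Between consecutive numbers, monotonicity is exactly the inequality for \<open>p\<close>
  at consecutive vertices.\<close>

lemma mono_lift: "mono lift"
proof (rule mono_iff_le_Suc[THEN iffD2], rule allI)
  fix k
  have "vertex (Suc k) = cyclic_succ n (vertex k)" using vertex_add[of k 1] by simp
  then show "lift k \<le> lift (Suc k)" using p[OF vertex_mem, of k] by (simp add: lift_def)
qed

text \<open>The lifted path ends over its starting vertex, so its displacement is a multiple of
  \<open>n\<close>. The number \<open>w\<close> counts the turns around the quiver; when
  \<open>m\<close> is the least period it is the weight of the cycle.\<close>

lemma lift_return:
  assumes "x \<in> {1..n}" "(f ^^ m) x = x"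
  obtains w where "(lift ^^ m) x = x + n * w" "(\<Sum>i<m. p ((f ^^ i) x)) = n * w"
proof -
  have eq: "(lift ^^ m) x = x + (\<Sum>i<m. p ((f ^^ i) x))"
    using funpow_lift[of m x] vertex_id[OF assms(1)] by simp
  have "vertex ((lift ^^ m) x) = vertex x"
    using assms vertex_funpow_lift vertex_id by simp
  then have "n dvd (lift ^^ m) x - x"
    unfolding vertex_eq_iff using eq by (metis le_add1 mod_eq_dvd_iff_nat)
  then obtain w where "(\<Sum>i<m. p ((f ^^ i) x)) = n * w"
    unfolding eq by auto
  then show ?thesis using that[of w] eq by simp
qed

text \<open>Each cycle passes its return time and displacement on to the point of the other cycle.
  Minimality of both periods then gives \<open>m = l\<close>, and the two displacements of
  \<open>x\<close> at this common time coincide.\<close>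

lemma cycle_weights_equal:
  assumes "x \<in> {1..n}" "x \<in> orbit f x" "y \<in> {1..n}" "y \<in> orbit f y"
  shows "(\<Sum>a\<in>orbit f x. p a) = (\<Sum>a\<in>orbit f y. p a)"
proof -
  obtain m where m: "m > 0" "(f ^^ m) x = x" "orbit f x = (\<lambda>i. (f ^^ i) x) ` {..<m}"
    "inj_on (\<lambda>i. (f ^^ i) x) {..<m}"
    using orbit_enum[OF assms(2)] .
  obtain l where l: "l > 0" "(f ^^ l) y = y" "orbit f y = (\<lambda>i. (f ^^ i) y) ` {..<l}"
    "inj_on (\<lambda>i. (f ^^ i) y) {..<l}"
    using orbit_enum[OF assms(4)] .
  obtain w where w: "(lift ^^ m) x = x + n * w" "(\<Sum>i<m. p ((f ^^ i) x)) = n * w"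
    using lift_return[OF assms(1) m(2)] .
  obtain v where v: "(lift ^^ l) y = y + n * v" "(\<Sum>i<l. p ((f ^^ i) y)) = n * v"
    using lift_return[OF assms(3) l(2)] .
  have xy: "x < y + n" "y < x + n" using assms(1,3) by auto
  have x': "(lift ^^ l) x = x + n * v"
    using monotone_degree_one_return[OF mono_lift lift_degree_one w(1) m(1) v(1) xy] .
  have y': "(lift ^^ m) y = y + n * w"
    using monotone_degree_one_return[OF mono_lift lift_degree_one v(1) l(1) w(1) xy(2,1)] .
  \<comment> \<open>A shift by a multiple of \<open>n\<close> does not change the vertex, so
    \<open>x\<close> also returns at time \<open>l\<close>, which cannot precede its least period
    \<open>m\<close>.\<close>
  have "(f ^^ l) x = x"
    using vertex_funpow_lift[of l x] unfolding x' vertex_id[OF assms(1)]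
    by (metis vertex_eq_iff vertex_id[OF assms(1)] mod_mult_self2)
  then have "m \<le> l"
    using m(1) l(1) inj_onD[OF m(4), of 0 l] by force
  have "(f ^^ m) y = y"
    using vertex_funpow_lift[of m y] unfolding y' vertex_id[OF assms(3)]
    by (metis vertex_eq_iff vertex_id[OF assms(3)] mod_mult_self2)
  then have "l \<le> m"
    using m(1) l(1) inj_onD[OF l(4), of 0 m] by force
  with \<open>m \<le> l\<close> have "m = l" by simp
  then have "n * w = n * v" using w(1) x' by (metis add_left_imp_eq)
  then have "(\<Sum>i<m. p ((f ^^ i) x)) = (\<Sum>i<l. p ((f ^^ i) y))" using w(2) v(2) by simp
  then show ?thesis
    unfolding m(3) l(3) by (simp add: sum.reindex[OF m(4)] sum.reindex[OF l(4)])
qed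

end

section \<open>Ideals of path algebras generated by paths\<close>

locale finite_quiver = wf_digraph Q for Q :: "('v, 'e) pre_digraph" (structure) +
  assumes finite_verts: "finite (verts Q)"
begin

abbreviation PA :: "('v \<times> 'e list \<Rightarrow> 'k::field) ring" where
  "PA \<equiv> path_algebra Q"

definition supported :: "('v \<times> 'e list) set \<Rightarrow> ('v \<times> 'e list \<Rightarrow> 'k::field) set" where
  "supported X = {f \<in> carrier PA. \<forall>x. f x \<noteq> 0 \<longrightarrow> x \<in> X}"

text \<open>Lists with a relation as a subpath. Being a path of the quiver is not demanded here;
  \<open>supported\<close> adds it through the carrier.\<close>

definition multiples :: "('v \<times> 'e list) set \<Rightarrow> ('v \<times> 'e list) set" where
  "multiples \<rho> = {(u, p). \<exists>q r s. p = q @ r @ s \<and> (path_target Q u q, r) \<in> \<rho>}"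

lemma PA_ring: "ring (PA :: ('v \<times> 'e list \<Rightarrow> 'k::field) ring)"
  by (rule path_algebra_ring[OF wf_digraph_axioms finite_verts])

lemma carrier_PA: "f \<in> carrier PA \<longleftrightarrow> finite {p. f p \<noteq> 0} \<and> {p. f p \<noteq> 0} \<subseteq> quiver_paths Q"
  by (simp add: path_algebra_def)

lemma zero_apply: "\<zero>\<^bsub>PA\<^esub> p = 0"
  by (simp add: path_algebra_def)

lemma add_apply: "(f \<oplus>\<^bsub>PA\<^esub> g) p = f p + g p"
  by (simp add: path_algebra_def)

lemma mult_apply: "(f \<otimes>\<^bsub>PA\<^esub> g) (u, p) =
    (\<Sum>i\<le>length p. f (u, take i p) * g (path_target Q u (take i p), drop i p))"
  by (simp add: path_algebra_def)

lemma mult_nonzeroE: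
  assumes "(f \<otimes>\<^bsub>PA\<^esub> g) (u, p) \<noteq> 0"
  obtains q r where "p = q @ r" "f (u, q) \<noteq> 0" "g (path_target Q u q, r) \<noteq> 0"
proof -
  from assms obtain i where "f (u, take i p) * g (path_target Q u (take i p), drop i p) \<noteq> 0"
    unfolding mult_apply by (auto elim: sum.not_neutral_contains_not_neutral)
  then show ?thesis using that[of "take i p" "drop i p"] by auto
qed

lemma supportedI: "f \<in> carrier PA \<Longrightarrow> (\<And>x. f x \<noteq> 0 \<Longrightarrow> x \<in> X) \<Longrightarrow> f \<in> supported X"
  by (simp add: supported_def)

lemma finite_support: "f \<in> carrier PA \<Longrightarrow> finite {x. f x \<noteq> 0}"
  by (simp add: carrier_PA)

lemma scale_closed: "f \<in> carrier PA \<Longrightarrow> (\<lambda>x. c * f x) \<in> carrier PA"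
  by (auto simp: carrier_PA elim!: rev_finite_subset)

lemma restrict_closed: "f \<in> carrier PA \<Longrightarrow> (\<lambda>x. if x \<in> X then f x else 0) \<in> carrier PA"
  by (auto simp: carrier_PA elim!: rev_finite_subset)

lemma single_path_closed: "x \<in> quiver_paths Q \<Longrightarrow> single_path x \<in> carrier PA"
  by (auto simp: carrier_PA single_path_def)

lemma uminus_apply:
  assumes "f \<in> carrier PA"
  shows "(\<ominus>\<^bsub>PA\<^esub> f) x = - f x"
proof -
  interpret ring PA by (rule PA_ring)
  have "\<ominus>\<^bsub>PA\<^esub> f = (\<lambda>x. (- 1) * f x)"
    using assms by (intro minus_equality scale_closed) (auto simp: path_algebra_def)
  then show ?thesis by simp
qed

lemma scalar_closed: "path_algebra_scalar Q c \<in> carrier PA"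
proof -
  interpret ring PA by (rule PA_ring)
  show ?thesis unfolding path_algebra_scalar_def by (intro scale_closed one_closed)
qed

lemma scalar_mult_apply:
  assumes "f \<in> carrier PA"
  shows "path_algebra_scalar Q c \<otimes>\<^bsub>PA\<^esub> f = (\<lambda>x. c * f x)"
proof (rule ext, clarify)
  interpret ring PA by (rule PA_ring)
  fix u and p :: "'e list"
  have "(path_algebra_scalar Q c \<otimes>\<^bsub>PA\<^esub> f) (u, p) = c * (\<one>\<^bsub>PA\<^esub> \<otimes>\<^bsub>PA\<^esub> f) (u, p)"
    unfolding mult_apply path_algebra_scalar_def by (simp add: sum_distrib_left mult.assoc)
  then show "(path_algebra_scalar Q c \<otimes>\<^bsub>PA\<^esub> f) (u, p) = c * f (u, p)"
    using assms by simp
qed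

lemma trivial_path_mult_apply:
  "(single_path (a, []) \<otimes>\<^bsub>PA\<^esub> f) (u, p) = (if u = a then f (u, p) else 0)"
proof -
  have "(single_path (a, []) \<otimes>\<^bsub>PA\<^esub> f) (u, p) =
      (\<Sum>i\<le>length p. if i = 0 then if u = a then f (u, p) else 0 else 0)"
    unfolding mult_apply by (rule sum.cong) (auto simp: single_path_def path_target_simps)
  then show ?thesis by simp
qed

lemma mult_trivial_path_apply:
  "(f \<otimes>\<^bsub>PA\<^esub> single_path (a, [])) (u, p) = (if path_target Q u p = a then f (u, p) else 0)"
proof -
  have "(f \<otimes>\<^bsub>PA\<^esub> single_path (a, [])) (u, p) =
      (\<Sum>i\<le>length p. if i = length p then if path_target Q u p = a then f (u, p) else 0 else 0)"
    unfolding mult_apply by (rule sum.cong) (auto simp: single_path_def)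
  then show ?thesis by simp
qed

lemma single_path_mult:
  assumes "path_target Q u p = v"
  shows "single_path (u, p) \<otimes>\<^bsub>PA\<^esub> single_path (v, q) = (single_path (u, p @ q) :: _ \<Rightarrow> 'k::field)"
proof (rule ext, clarify)
  fix x and r :: "'e list"
  have "(single_path (u, p) \<otimes>\<^bsub>PA\<^esub> single_path (v, q)) (x, r) =
      (\<Sum>i\<le>length r. if i = length p then if x = u \<and> r = p @ q then 1 else 0 else 0 :: 'k)"
    unfolding mult_apply
  proof (rule sum.cong)
    fix i assume "i \<in> {..length r}"
    then have "take i r = p \<and> drop i r = q \<longleftrightarrow> i = length p \<and> r = p @ q"
      by (metis append_eq_conv_conj append_take_drop_id atMost_iff length_take min.absorb2)
    then have "x = u \<and> take i r = p \<and> path_target Q x (take i r) = v \<and> drop i r = q \<longleftrightarrow>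
        i = length p \<and> x = u \<and> r = p @ q"
      using assms by metis
    moreover have "single_path (u, p) (x, take i r) * single_path (v, q) (path_target Q x (take i r), drop i r) =
        (if x = u \<and> take i r = p \<and> path_target Q x (take i r) = v \<and> drop i r = q then 1 else 0 :: 'k)"
      by (auto simp: single_path_def)
    ultimately show "single_path (u, p) (x, take i r) * single_path (v, q) (path_target Q x (take i r), drop i r) =
        (if i = length p then if x = u \<and> r = p @ q then 1 else 0 else 0 :: 'k)"
      by simp
  qed simp
  also have "\<dots> = single_path (u, p @ q) (x, r)"
    by (auto simp: single_path_def)
  finally show "(single_path (u, p) \<otimes>\<^bsub>PA\<^esub> single_path (v, q)) (x, r) = (single_path (u, p @ q) (x, r) :: 'k)" .
qed

lemma multiplesI: "(path_target Q u q, r) \<in> \<rho> \<Longrightarrow> (u, q @ r @ s) \<in> multiples \<rho>"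
  unfolding multiples_def by blast

lemma multiples_append_left:
  assumes "(path_target Q u q, r) \<in> multiples \<rho>"
  shows "(u, q @ r) \<in> multiples \<rho>"
proof -
  obtain q' r' s where "r = q' @ r' @ s" "(path_target Q (path_target Q u q) q', r') \<in> \<rho>"
    using assms unfolding multiples_def by blast
  then show ?thesis using multiplesI[of u "q @ q'" r' \<rho> s] by (simp add: path_target_simps)
qed

lemma multiples_append_right:
  assumes "(u, q) \<in> multiples \<rho>"
  shows "(u, q @ r) \<in> multiples \<rho>"
proof -
  obtain q' r' s where "q = q' @ r' @ s" "(path_target Q u q', r') \<in> \<rho>"
    using assms unfolding multiples_def by blast
  then show ?thesis using multiplesI[of u q' r' \<rho> "s @ r"] by simp
qed

text \<open>Each path in a product is a concatenation of paths from the two factors, and a subpath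
  from \<open>\<rho>\<close> survives extension on either side.\<close>

lemma supported_multiples_ideal: "ideal (supported (multiples \<rho>)) (PA :: ('v \<times> 'e list \<Rightarrow> 'k::field) ring)"
proof -
  let ?R = "PA :: ('v \<times> 'e list \<Rightarrow> 'k) ring"
  interpret ring ?R by (rule PA_ring)
  show ?thesis
  proof (rule idealI[OF PA_ring])
    show "subgroup (supported (multiples \<rho>)) (add_monoid ?R)"
    proof (rule add.subgroupI)
      show "supported (multiples \<rho>) \<subseteq> carrier ?R"
        by (auto simp: supported_def)
      have "\<zero>\<^bsub>?R\<^esub> \<in> supported (multiples \<rho>)"
        by (simp add: supported_def zero_apply)
      then show "supported (multiples \<rho>) \<noteq> ({} :: ('v \<times> 'e list \<Rightarrow> 'k) set)" by blast
      show "\<ominus>\<^bsub>?R\<^esub> f \<in> supported (multiples \<rho>)" if "f \<in> supported (multiples \<rho>)" for f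
        using that by (auto simp: supported_def uminus_apply)
      show "f \<oplus>\<^bsub>?R\<^esub> g \<in> supported (multiples \<rho>)"
        if "f \<in> supported (multiples \<rho>)" "g \<in> supported (multiples \<rho>)" for f g
        using that by (auto simp: supported_def add_apply) force
    qed
    fix f g :: "'v \<times> 'e list \<Rightarrow> 'k"
    assume f: "f \<in> supported (multiples \<rho>)" and g: "g \<in> carrier ?R"
    show "g \<otimes>\<^bsub>?R\<^esub> f \<in> supported (multiples \<rho>)"
    proof (rule supportedI)
      fix x assume "(g \<otimes>\<^bsub>?R\<^esub> f) x \<noteq> 0"
      then show "x \<in> multiples \<rho>"
        using f multiples_append_left by (cases x) (auto simp: supported_def elim!: mult_nonzeroE)
    qed (use f g in \<open>simp add: supported_def\<close>)
    show "f \<otimes>\<^bsub>?R\<^esub> g \<in> supported (multiples \<rho>)"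
    proof (rule supportedI)
      fix x assume "(f \<otimes>\<^bsub>?R\<^esub> g) x \<noteq> 0"
      then show "x \<in> multiples \<rho>"
        using f multiples_append_right by (cases x) (auto simp: supported_def elim!: mult_nonzeroE)
    qed (use f g in \<open>simp add: supported_def\<close>)
  qed
qed

lemma single_path_multiple_mem:
  assumes I: "ideal I (PA :: ('v \<times> 'e list \<Rightarrow> 'k::field) ring)" and "single_path ` \<rho> \<subseteq> I"
    and "x \<in> quiver_paths Q" "x \<in> multiples \<rho>"
  shows "single_path x \<in> I"
proof -
  obtain u q r s where x: "x = (u, q @ r @ s)" and \<rho>: "(path_target Q u q, r) \<in> \<rho>"
    using assms(4) unfolding multiples_def by blast
  have paths: "(u, q) \<in> quiver_paths Q" "(path_target Q (path_target Q u q) r, s) \<in> quiver_paths Q"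
    using assms(3) unfolding x by (auto simp: quiver_paths_append[OF wf_digraph_axioms])
  have "single_path (path_target Q u q, r @ s) \<in> I"
    using ideal.I_r_closed[OF I _ single_path_closed[OF paths(2)]] assms(2) \<rho>
    by (metis single_path_mult image_subset_iff)
  then show ?thesis
    using ideal.I_l_closed[OF I _ single_path_closed[OF paths(1)]] unfolding x
    by (metis single_path_mult)
qed

text \<open>Induction on the size of the support: splitting off one path \<open>x\<close> leaves a
  smaller element, and the split-off part is a scalar multiple of a path that the ideal
  contains.\<close>

lemma supported_multiples_subset:
  assumes I: "ideal I (PA :: ('v \<times> 'e list \<Rightarrow> 'k::field) ring)" and "single_path ` \<rho> \<subseteq> I"
  shows "supported (multiples \<rho>) \<subseteq> I"
proof
  fix f :: "'v \<times> 'e list \<Rightarrow> 'k" assume "f \<in> supported (multiples \<rho>)"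
  then show "f \<in> I"
  proof (induction "card {x. f x \<noteq> 0}" arbitrary: f rule: less_induct)
    case less
    interpret ideal I "PA :: ('v \<times> 'e list \<Rightarrow> 'k) ring" by (rule I)
    have f: "f \<in> carrier PA" using less.prems by (simp add: supported_def)
    show ?case
    proof (cases "\<exists>x. f x \<noteq> 0")
      case False
      then have "f = \<zero>\<^bsub>PA\<^esub>" by (simp add: fun_eq_iff zero_apply)
      then show ?thesis using additive_subgroup.zero_closed[OF is_additive_subgroup] by simp
    next
      case True
      then obtain x where x: "f x \<noteq> 0" by blast
      let ?g = "\<lambda>y. if y \<in> - {x} then f y else 0"
      have g: "?g \<in> supported (multiples \<rho>)"
        using less.prems by (intro supportedI restrict_closed) (auto simp: supported_def split: if_splits)
      have "{y. ?g y \<noteq> 0} \<subset> {y. f y \<noteq> 0}" using x by auto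
      then have lt: "card {y. ?g y \<noteq> 0} < card {y. f y \<noteq> 0}"
        by (rule psubset_card_mono[OF finite_support[OF f]])
      have gI: "?g \<in> I" by (rule less.hyps[OF lt g])
      have x': "x \<in> quiver_paths Q" "x \<in> multiples \<rho>"
        using x f less.prems unfolding carrier_PA supported_def by blast+
      have "path_algebra_scalar Q (f x) \<otimes>\<^bsub>PA\<^esub> single_path x \<in> I"
        using I_l_closed[OF single_path_multiple_mem[OF I assms(2) x'] scalar_closed] .
      then have "?g \<oplus>\<^bsub>PA\<^esub> (path_algebra_scalar Q (f x) \<otimes>\<^bsub>PA\<^esub> single_path x) \<in> I"
        using gI additive_subgroup.a_closed[OF is_additive_subgroup] by blast
      also have "?g \<oplus>\<^bsub>PA\<^esub> (path_algebra_scalar Q (f x) \<otimes>\<^bsub>PA\<^esub> single_path x) = f"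
        unfolding scalar_mult_apply[OF single_path_closed[OF x'(1)]]
        by (auto simp: fun_eq_iff add_apply single_path_def)
      finally show ?thesis .
    qed
  qed
qed

text \<open>An ideal generated by paths is spanned by paths, so membership can be tested coefficient
  by coefficient.\<close>

lemma genideal_eq_supported:
  assumes "\<rho> \<subseteq> quiver_paths Q"
  shows "Idl\<^bsub>PA\<^esub> (single_path ` \<rho>) = (supported (multiples \<rho>) :: ('v \<times> 'e list \<Rightarrow> 'k::field) set)"
proof
  interpret ring "PA :: ('v \<times> 'e list \<Rightarrow> 'k) ring" by (rule PA_ring)
  have sub: "(single_path ` \<rho> :: ('v \<times> 'e list \<Rightarrow> 'k) set) \<subseteq> carrier PA"
    using assms single_path_closed by blast
  have "x \<in> multiples \<rho>" if "x \<in> \<rho>" for x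
    using multiplesI[of "fst x" "[]" "snd x" \<rho> "[]"] that by (simp add: path_target_simps)
  then have "(single_path ` \<rho> :: ('v \<times> 'e list \<Rightarrow> 'k) set) \<subseteq> supported (multiples \<rho>)"
    using sub by (auto simp: supported_def single_path_def split: if_splits)
  then show "Idl\<^bsub>PA\<^esub> (single_path ` \<rho>) \<subseteq> (supported (multiples \<rho>) :: ('v \<times> 'e list \<Rightarrow> 'k) set)"
    by (rule genideal_minimal[OF supported_multiples_ideal])
  show "(supported (multiples \<rho>) :: ('v \<times> 'e list \<Rightarrow> 'k) set) \<subseteq> Idl\<^bsub>PA\<^esub> (single_path ` \<rho>)"
    using supported_multiples_subset[OF genideal_ideal[OF sub] genideal_self[OF sub]] .
qed

end

section \<open>Dimensions in Nakayama algebras\<close>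

context algebra_over_field
begin

lemma scalar_zero: "scalar 0 = \<zero>"
  using scalar_add[of 0 0] add.l_cancel_one[OF scalar_closed scalar_closed, of 0 0] by simp

lemma scalar_uminus: "scalar (- c) = \<ominus> scalar c"
  using scalar_add[of "- c" c] scalar_closed by (intro minus_equality[symmetric]) (simp_all add: scalar_zero)

text \<open>The notion of dimension is relative to a subfield of \<open>A\<close>; the scalars form
  one because \<open>scalar\<close> carries inverses of the field into \<open>A\<close>.\<close>

lemma subfield_scalars:
  assumes "\<one> \<noteq> \<zero>"
  shows "subfield (range scalar) A"
proof (rule subfieldI)
  show "subcring (range scalar) A"
  proof (rule subcringI)
    show "subring (range scalar) A"
    proof (rule subringI)
      show "\<one> \<in> range scalar" using scalar_one by (metis rangeI)
    qed (auto simp: scalar_closed simp flip: scalar_uminus scalar_mult scalar_add)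
  qed (use scalar_closed scalar_central in blast)
  show "Units (A \<lparr> carrier := range scalar \<rparr>) = range scalar - {\<zero>}"
  proof (intro equalityI subsetI)
    fix x assume x: "x \<in> range scalar - {\<zero>}"
    then obtain c where c: "x = scalar c" by blast
    with x have "c \<noteq> 0" using scalar_zero by auto
    then have "scalar (inverse c) \<otimes> x = \<one>" "x \<otimes> scalar (inverse c) = \<one>"
      by (simp_all add: c scalar_one flip: scalar_mult)
    then show "x \<in> Units (A \<lparr> carrier := range scalar \<rparr>)"
      using c unfolding Units_def by auto
  qed (use assms scalar_closed in \<open>auto simp: Units_def\<close>)
qed

end

text \<open>Lets a list of coefficients be read as a function on the paths of a basis list.\<close>

lemma lists_eq_map:
  assumes "distinct xs" "length ys = length xs"
  shows "\<exists>g. ys = map g xs"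
proof
  show "ys = map (the \<circ> map_of (zip xs ys)) xs"
    using assms by (intro nth_equalityI) (simp_all add: map_of_zip_nth)
qed

section \<open>Residues of paths as bases\<close>

context nakayama_algebra
begin

sublocale quiver: finite_quiver "cyclic_quiver n"
  rewrites "verts (cyclic_quiver n) = {1..n}"
proof -
  interpret fin_digraph "cyclic_quiver n" by (rule cyclic_quiver_fin_digraph)
  show "finite_quiver (cyclic_quiver n)" by unfold_locales (simp add: cyclic_quiver_def)
qed (simp add: cyclic_quiver_def)

abbreviation paths :: "(nat \<times> nat list) set" where
  "paths \<equiv> quiver_paths (cyclic_quiver n)"

abbreviation zero_paths :: "(nat \<times> nat list) set" where
  "zero_paths \<equiv> quiver.multiples \<rho>"

abbreviation PA :: "(nat \<times> nat list \<Rightarrow> 'k) ring" where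
  "PA \<equiv> path_algebra (cyclic_quiver n)"

lemma relations_ideal: "Idl\<^bsub>PA\<^esub> (single_path ` \<rho>) = quiver.supported zero_paths"
  using relations_nontrivial_paths by (intro quiver.genideal_eq_supported) blast

lemma residue_eq: "residue = \<phi> \<circ> (+>\<^bsub>PA\<^esub>) (quiver.supported zero_paths)"
  by (simp add: fun_eq_iff residue_def relations_ideal)

lemma residue_hom: "residue \<in> ring_hom PA A"
  unfolding residue_eq
  using iso ideal.rcos_ring_hom[OF quiver.supported_multiples_ideal[where \<rho> = \<rho>]]
  by (auto simp: ring_iso_def relations_ideal intro: ring_hom_trans)

sublocale residue: ring_hom_ring PA A residue
  using quiver.PA_ring ring_axioms residue_hom by (intro ring_hom_ringI2)

lemma residue_surj: "carrier A = residue ` carrier PA"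
proof -
  have "carrier A = \<phi> ` carrier (PA Quot quiver.supported zero_paths)"
    using iso by (simp add: ring_iso_def bij_betw_def relations_ideal)
  also have "carrier (PA Quot quiver.supported zero_paths) =
      (+>\<^bsub>PA\<^esub>) (quiver.supported zero_paths) ` carrier PA"
    by (auto simp: FactRing_def A_RCOSETS_def')
  finally show ?thesis by (simp add: residue_eq image_comp)
qed

text \<open>Injectivity of \<open>\<phi>\<close> means that only the ideal itself is sent to zero,
  and that ideal consists of the combinations of zero paths.\<close>

lemma residue_eq_zero_iff:
  assumes f: "f \<in> carrier PA"
  shows "residue f = \<zero> \<longleftrightarrow> (\<forall>x. f x \<noteq> 0 \<longrightarrow> x \<in> zero_paths)"
proof -
  let ?I = "quiver.supported zero_paths :: (nat \<times> nat list \<Rightarrow> 'k) set"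
  have I: "ideal ?I PA" by (rule quiver.supported_multiples_ideal)
  have \<phi>: "\<phi> \<in> ring_hom (PA Quot ?I) A" "inj_on \<phi> (carrier (PA Quot ?I))"
    using iso by (auto simp: ring_iso_def bij_betw_def relations_ideal)
  have q: "ring (PA Quot ?I)" by (rule ideal.quotient_is_ring[OF I])
  have "\<phi> ?I = \<zero>"
    using ring_hom_zero[OF \<phi>(1) q ring_axioms] by (simp add: FactRing_def)
  moreover have "?I \<in> carrier (PA Quot ?I)"
    using ring.ring_simprules(2)[OF q] by (simp add: FactRing_def)
  moreover have "?I +>\<^bsub>PA\<^esub> f \<in> carrier (PA Quot ?I)"
    using f by (auto simp: FactRing_def A_RCOSETS_def')
  ultimately have "residue f = \<zero> \<longleftrightarrow> ?I +>\<^bsub>PA\<^esub> f = ?I"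
    using inj_on_eq_iff[OF \<phi>(2), of "?I +>\<^bsub>PA\<^esub> f" ?I] by (simp add: residue_eq)
  also have "\<dots> \<longleftrightarrow> f \<in> ?I"
    using ring.a_rcos_zero[OF quiver.PA_ring I] ideal.rcos_const_imp_mem[OF I f] by blast
  finally show ?thesis using f by (simp add: quiver.supported_def)
qed

lemma residue_eq_iff:
  assumes f: "f \<in> carrier PA" and g: "g \<in> carrier PA"
  shows "residue f = residue g \<longleftrightarrow> (\<forall>x. x \<notin> zero_paths \<longrightarrow> f x = g x)"
proof -
  have "residue f = residue g \<longleftrightarrow> residue (f \<ominus>\<^bsub>PA\<^esub> g) = \<zero>"
    using f g by (simp add: a_minus_def)
      (metis a_minus_def r_right_minus_eq residue.hom_closed)
  also have "\<dots> \<longleftrightarrow> (\<forall>x. x \<notin> zero_paths \<longrightarrow> f x = g x)"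
    using f g by (subst residue_eq_zero_iff) (auto simp: a_minus_def quiver.add_apply quiver.uminus_apply)
  finally show ?thesis .
qed

lemma scalar_residue:
  assumes "f \<in> carrier PA"
  shows "scalar c \<otimes> residue f = residue (\<lambda>x. c * f x)"
proof -
  have "scalar c = residue (path_algebra_scalar (cyclic_quiver n) c)"
    using iso_scalar[of c] by (simp add: residue_def)
  then show ?thesis
    using residue.hom_mult[OF quiver.scalar_closed assms, of c] quiver.scalar_mult_apply[OF assms] by simp
qed

text \<open>Translates list-based linear combinations into coefficient functions. Membership in the
  carrier is part of the induction because additivity of \<open>residue\<close> relies on
  it.\<close>

lemma combine_single_paths:
  assumes "distinct ps" "set ps \<subseteq> paths"
  shows "(\<lambda>x. if x \<in> set ps then c x else 0) \<in> carrier PA \<and>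
    combine (map (\<lambda>x. scalar (c x)) ps) (map (\<lambda>x. residue (single_path x)) ps) =
      residue (\<lambda>x. if x \<in> set ps then c x else 0)"
  using assms
proof (induction ps)
  case Nil
  have "(\<lambda>x. 0) = \<zero>\<^bsub>PA\<^esub>" by (simp add: fun_eq_iff quiver.zero_apply)
  then show ?case by simp
next
  case (Cons y ps)
  let ?g = "\<lambda>x. if x \<in> set ps then c x else 0" and ?s = "\<lambda>x. c y * single_path y x"
  have y: "single_path y \<in> carrier PA" using Cons.prems by (simp add: quiver.single_path_closed)
  have s: "?s \<in> carrier PA" using quiver.scale_closed[OF y] .
  have g: "?g \<in> carrier PA" using Cons by simp
  have eq: "?s \<oplus>\<^bsub>PA\<^esub> ?g = (\<lambda>x. if x \<in> set (y # ps) then c x else 0)"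
    using Cons.prems by (auto simp: fun_eq_iff quiver.add_apply single_path_def)
  have "residue (?s \<oplus>\<^bsub>PA\<^esub> ?g) = residue ?s \<oplus> residue ?g" using s g by simp
  moreover have "?s \<oplus>\<^bsub>PA\<^esub> ?g \<in> carrier PA" using s g by simp
  ultimately show ?case
    using Cons scalar_residue[OF y, of "c y"] unfolding eq by simp
qed

lemma Span_single_paths_iff:
  assumes K: "subfield (range scalar) A" and ps: "distinct ps" "set ps \<subseteq> paths"
  shows "a \<in> Span (range scalar) (map (\<lambda>x. residue (single_path x)) ps) \<longleftrightarrow>
    (\<exists>c. a = residue (\<lambda>x. if x \<in> set ps then c x else 0))"
proof -
  have carr: "set (map (\<lambda>x. residue (single_path x)) ps) \<subseteq> carrier A"
    using ps(2) by (auto intro!: residue.hom_closed quiver.single_path_closed)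
  show ?thesis
    unfolding Span_mem_iff_length_version[OF K carr]
  proof
    assume "\<exists>Ks. set Ks \<subseteq> range scalar \<and> length Ks = length (map (\<lambda>x. residue (single_path x)) ps) \<and>
      a = combine Ks (map (\<lambda>x. residue (single_path x)) ps)"
    then obtain Ks where Ks: "set Ks \<subseteq> range scalar" "length Ks = length ps"
      "a = combine Ks (map (\<lambda>x. residue (single_path x)) ps)" by auto
    obtain g where g: "Ks = map g ps" using lists_eq_map[OF ps(1) Ks(2)] by blast
    have "\<forall>x\<in>set ps. \<exists>c. g x = scalar c" using Ks(1) unfolding g by auto
    from bchoice[OF this] obtain c where "\<forall>x\<in>set ps. g x = scalar (c x)" by blast
    then have "Ks = map (\<lambda>x. scalar (c x)) ps" by (simp add: g)
    then show "\<exists>c. a = residue (\<lambda>x. if x \<in> set ps then c x else 0)"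
      using Ks(3) combine_single_paths[OF ps] by blast
  next
    assume "\<exists>c. a = residue (\<lambda>x. if x \<in> set ps then c x else 0)"
    then obtain c where "a = combine (map (\<lambda>x. scalar (c x)) ps) (map (\<lambda>x. residue (single_path x)) ps)"
      using combine_single_paths[OF ps] by force
    then show "\<exists>Ks. set Ks \<subseteq> range scalar \<and> length Ks = length (map (\<lambda>x. residue (single_path x)) ps) \<and>
        a = combine Ks (map (\<lambda>x. residue (single_path x)) ps)"
      by (intro exI[of _ "map (\<lambda>x. scalar (c x)) ps"]) auto
  qed
qed

text \<open>In a dependence, compare the coefficients at the head path \<open>y\<close>: a residue
  determines them since \<open>y\<close> is not a zero path.\<close>

lemma independent_single_paths:
  assumes K: "subfield (range scalar) A" and "distinct ps" "set ps \<subseteq> paths - zero_paths"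
  shows "independent (range scalar) (map (\<lambda>x. residue (single_path x)) ps)"
  using assms(2,3)
proof (induction ps)
  case (Cons y ps)
  have y: "single_path y \<in> carrier PA" using Cons.prems by (intro quiver.single_path_closed) auto
  have "residue (single_path y) \<notin> Span (range scalar) (map (\<lambda>x. residue (single_path x)) ps)"
  proof
    assume "residue (single_path y) \<in> Span (range scalar) (map (\<lambda>x. residue (single_path x)) ps)"
    then obtain c where "residue (single_path y) = residue (\<lambda>x. if x \<in> set ps then c x else 0)"
      using Span_single_paths_iff[OF K, of ps] Cons.prems by (auto simp del: Span.simps)
    moreover have "(\<lambda>x. if x \<in> set ps then c x else 0) \<in> carrier PA"
      using combine_single_paths[of ps c] Cons.prems by auto
    moreover have "y \<notin> zero_paths" using Cons.prems by auto
    ultimately have "single_path y y = (if y \<in> set ps then c y else 0)"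
      using residue_eq_iff[OF y] by blast
    then show False using Cons.prems by (simp add: single_path_def)
  qed
  then show ?case using Cons y by (auto intro!: li_Cons simp del: Span.simps)
qed simp

text \<open>The nonzero paths in \<open>X\<close> form a basis: they span because changing
  coefficients at zero paths does not alter the residue.\<close>

lemma dimension_residue_supported:
  assumes K: "subfield (range scalar) A" and "X \<subseteq> paths" "finite (X - zero_paths)"
  shows "dimension (card (X - zero_paths)) (range scalar) (residue ` quiver.supported X)"
proof -
  obtain ps where ps: "distinct ps" "set ps = X - zero_paths"
    using finite_distinct_list[OF assms(3)] by blast
  have sub: "set ps \<subseteq> paths" using ps assms(2) by auto
  have "Span (range scalar) (map (\<lambda>x. residue (single_path x)) ps) = residue ` quiver.supported X"
  proof (intro equalityI subsetI)
    fix a assume "a \<in> Span (range scalar) (map (\<lambda>x. residue (single_path x)) ps)"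
    then obtain c where "a = residue (\<lambda>x. if x \<in> set ps then c x else 0)"
      using Span_single_paths_iff[OF K ps(1) sub] by blast
    moreover have "(\<lambda>x. if x \<in> set ps then c x else 0) \<in> quiver.supported X"
      using combine_single_paths[OF ps(1) sub] ps(2)
      by (intro quiver.supportedI) (auto split: if_splits)
    ultimately show "a \<in> residue ` quiver.supported X" by blast
  next
    fix a assume "a \<in> residue ` quiver.supported X"
    then obtain f where f: "a = residue f" "f \<in> carrier PA" "\<And>x. f x \<noteq> 0 \<Longrightarrow> x \<in> X"
      by (auto simp: quiver.supported_def)
    have "residue f = residue (\<lambda>x. if x \<in> set ps then f x else 0)"
      using f ps(2) by (subst residue_eq_iff[OF f(2) quiver.restrict_closed[OF f(2)]]) auto
    then show "a \<in> Span (range scalar) (map (\<lambda>x. residue (single_path x)) ps)"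
      using Span_single_paths_iff[OF K ps(1) sub] f(1) by blast
  qed
  moreover have "independent (range scalar) (map (\<lambda>x. residue (single_path x)) ps)"
    using independent_single_paths[OF K ps(1)] ps(2) assms(2) by blast
  ultimately have "dimension (length ps) (range scalar) (residue ` quiver.supported X)"
    using dimensionI[OF K] by force
  then show ?thesis using distinct_card[OF ps(1)] ps(2) by simp
qed

lemma dim_residue_supported:
  assumes "subfield (range scalar) A" "X \<subseteq> paths" "finite (X - zero_paths)"
  shows "dim (range scalar) (residue ` quiver.supported X) = card (X - zero_paths)"
  using dimI[OF assms(1) dimension_residue_supported[OF assms]] by (simp add: over_def)

text \<open>Otherwise there would be \<open>d + 1\<close> independent residues in an algebra of
  dimension \<open>d\<close>.\<close>

lemma finite_nonzero_paths:
  assumes K: "subfield (range scalar) A"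
  shows "finite (paths - zero_paths)"
proof (rule ccontr)
  assume "infinite (paths - zero_paths)"
  obtain d where d: "dimension d (range scalar) (carrier A)"
    using finite_dimensional by auto
  obtain X where X: "X \<subseteq> paths - zero_paths" "card X = Suc d" "finite X"
    using infinite_arbitrarily_large[OF \<open>infinite (paths - zero_paths)\<close>] by blast
  obtain ps where ps: "distinct ps" "set ps = X"
    using finite_distinct_list[OF X(3)] by blast
  have "independent (range scalar) (map (\<lambda>x. residue (single_path x)) ps)"
    using independent_single_paths[OF K ps(1)] ps(2) X(1) by blast
  then have "length ps \<le> d"
    using independent_length_le_dimension[OF K d] independent_in_carrier by fastforce
  then show False using distinct_card[OF ps(1)] ps(2) X(2) by simp
qed

end

section \<open>Walks on the cyclic quiver\<close>

text \<open>The arrow list of the only path of length \<open>l\<close> from \<open>a\<close>. Arrows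
  are named by their sources, so it lists the visited vertices except the last.\<close>

definition cyclic_walk :: "nat \<Rightarrow> nat \<Rightarrow> nat \<Rightarrow> nat list" where
  "cyclic_walk n a l = map (\<lambda>i. (cyclic_succ n ^^ i) a) [0..<l]"

lemma length_cyclic_walk [simp]: "length (cyclic_walk n a l) = l"
  by (simp add: cyclic_walk_def)

lemma cyclic_walk_0 [simp]: "cyclic_walk n a 0 = []"
  by (simp add: cyclic_walk_def)

lemma cyclic_walk_Suc: "cyclic_walk n a (Suc l) = a # cyclic_walk n (cyclic_succ n a) l"
  by (simp add: cyclic_walk_def upt_conv_Cons map_Suc_upt[symmetric] funpow_swap1 comp_def del: upt_Suc)

lemma cyclic_walk_add:
  "cyclic_walk n a (k + l) = cyclic_walk n a k @ cyclic_walk n ((cyclic_succ n ^^ k) a) l"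
  by (induction k arbitrary: a) (simp_all add: cyclic_walk_Suc funpow_swap1)

text \<open>Each vertex has one outgoing arrow, so start and length determine a walk. This serves
  both the cyclic quiver and the resolution quiver.\<close>

lemma cas_functional:
  assumes "tail G = (\<lambda>a. a)"
  shows "pre_digraph.cas G u p v \<longleftrightarrow>
    p = map (\<lambda>i. (head G ^^ i) u) [0..<length p] \<and> v = (head G ^^ length p) u"
proof (induction p arbitrary: u)
  case (Cons a p)
  have "map (\<lambda>i. (head G ^^ i) u) [0..<length (a # p)] =
      u # map (\<lambda>i. (head G ^^ i) (head G u)) [0..<length p]"
    by (simp add: upt_conv_Cons map_Suc_upt[symmetric] funpow_swap1 comp_def del: upt_Suc)
  then show ?case
    using Cons[of "head G u"] assms by (auto simp: pre_digraph.cas.simps funpow_swap1)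
qed (auto simp: pre_digraph.cas.simps)

lemma awalk_verts_functional:
  assumes "tail G = (\<lambda>a. a)"
  shows "pre_digraph.awalk_verts G u (map (\<lambda>i. (head G ^^ i) u) [0..<l]) =
    map (\<lambda>i. (head G ^^ i) u) [0..<Suc l]"
proof (induction l arbitrary: u)
  case (Suc l)
  have "map (\<lambda>i. (head G ^^ i) u) [0..<Suc k] = u # map (\<lambda>i. (head G ^^ i) (head G u)) [0..<k]" for k
    by (simp add: upt_conv_Cons map_Suc_upt[symmetric] funpow_swap1 comp_def del: upt_Suc)
  then show ?case
    using Suc[of "head G u"] assms by (simp add: pre_digraph.awalk_verts.simps del: upt_Suc)
qed (simp add: pre_digraph.awalk_verts.simps)

lemma quiver_paths_cyclic:
  assumes "n \<ge> 1"
  shows "(u, p) \<in> quiver_paths (cyclic_quiver n) \<longleftrightarrow> u \<in> {1..n} \<and> p = cyclic_walk n u (length p)"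
proof -
  have "set (cyclic_walk n u (length p)) \<subseteq> {1..n}" if "u \<in> {1..n}"
    using funpow_cyclic_succ_mem[OF assms that] by (auto simp: cyclic_walk_def)
  then have "set p \<subseteq> {1..n}" if "u \<in> {1..n}" "p = cyclic_walk n u (length p)"
    using that by metis
  moreover have "pre_digraph.cas (cyclic_quiver n) u p v \<longleftrightarrow>
      p = cyclic_walk n u (length p) \<and> v = (cyclic_succ n ^^ length p) u" for v
    using cas_functional[of "cyclic_quiver n" u p v] by (simp add: cyclic_quiver_def cyclic_walk_def)
  moreover have "verts (cyclic_quiver n) = {1..n}" "arcs (cyclic_quiver n) = {1..n}"
    by (simp_all add: cyclic_quiver_def)
  ultimately show ?thesis
    unfolding quiver_paths_def pre_digraph.awalk_def by auto
qed

lemma path_target_cyclic: "path_target (cyclic_quiver n) u (cyclic_walk n u l) = (cyclic_succ n ^^ l) u"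
  using awalk_verts_functional[of "cyclic_quiver n" u l]
  by (simp add: path_target_def cyclic_walk_def cyclic_quiver_def)

text \<open>Turns a count into a threshold: the set ends at its least missing number.\<close>

lemma finite_downward_closed:
  assumes "finite (S :: nat set)" "\<And>k. Suc k \<in> S \<Longrightarrow> k \<in> S"
  shows "S = {..<card S}"
proof -
  have down: "j \<in> S" if "j \<le> k" "k \<in> S" for j k
    using that(1,2) by (induction rule: dec_induct) (auto intro: assms(2))
  obtain m where m: "m \<notin> S" using assms(1) infinite_UNIV_nat by (metis UNIV_eq_I)
  define l where "l = (LEAST l. l \<notin> S)"
  have "l \<notin> S" unfolding l_def using m by (rule LeastI)
  moreover have "j \<in> S" if "j < l" for j
    using not_less_Least[of j "\<lambda>l. l \<notin> S"] that unfolding l_def by blast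
  ultimately have "S = {..<l}" using down by (meson equalityI lessThan_iff not_less subsetI)
  then show ?thesis by simp
qed

section \<open>Projectives, the graded Cartan matrix and the recursion\<close>

context nakayama_algebra
begin

text \<open>Left multiplication by a trivial path projects onto the coefficients of paths starting
  there, so its image is its set of fixed elements.\<close>

lemma residue_image_left:
  "{idempotent a \<otimes> x |x. x \<in> carrier A} = residue ` quiver.supported {(u, p) \<in> paths. u = a}"
  if "a \<in> {1..n}"
proof -
  have a: "single_path (a, []) \<in> carrier PA"
    using that order_pos by (intro quiver.single_path_closed) (simp add: quiver_paths_cyclic)
  have "{idempotent a \<otimes> x |x. x \<in> carrier A} = residue ` (\<lambda>f. single_path (a, []) \<otimes>\<^bsub>PA\<^esub> f) ` carrier PA"
    unfolding residue_surj idempotent_def using a by (auto simp: image_iff)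
  also have "(\<lambda>f. single_path (a, []) \<otimes>\<^bsub>PA\<^esub> f) ` carrier PA = quiver.supported {(u, p) \<in> paths. u = a}"
  proof (intro equalityI subsetI)
    fix f assume "f \<in> (\<lambda>f. single_path (a, []) \<otimes>\<^bsub>PA\<^esub> f) ` carrier PA"
    then obtain g where g: "g \<in> carrier PA" "f = single_path (a, []) \<otimes>\<^bsub>PA\<^esub> g" by blast
    then show "f \<in> quiver.supported {(u, p) \<in> paths. u = a}"
      using a by (auto simp: quiver.supported_def quiver.trivial_path_mult_apply quiver.carrier_PA[of g])
  next
    fix f :: "nat \<times> nat list \<Rightarrow> 'k" assume f: "f \<in> quiver.supported {(u, p) \<in> paths. u = a}"
    then have "single_path (a, []) \<otimes>\<^bsub>PA\<^esub> f = f"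
      by (auto simp: fun_eq_iff quiver.trivial_path_mult_apply quiver.supported_def)
    then show "f \<in> (\<lambda>f. single_path (a, []) \<otimes>\<^bsub>PA\<^esub> f) ` carrier PA"
      using f by (intro image_eqI[of _ _ f]) (auto simp: quiver.supported_def)
  qed
  finally show ?thesis .
qed

lemma residue_image_degree:
  assumes "a \<in> {1..n}" "b \<in> {1..n}"
  shows "{idempotent b \<otimes> x \<otimes> idempotent a |x. x \<in> degree_part l} = residue ` quiver.supported
    {(u, p) \<in> paths. u = b \<and> length p = l \<and> path_target (cyclic_quiver n) u p = a}"
proof -
  let ?X = "{(u, p) \<in> paths. u = b \<and> length p = l \<and> path_target (cyclic_quiver n) u p = a}"
  let ?D = "path_algebra_degree (cyclic_quiver n) l :: (nat \<times> nat list \<Rightarrow> 'k) set"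
  let ?c = "\<lambda>f. single_path (b, []) \<otimes>\<^bsub>PA\<^esub> f \<otimes>\<^bsub>PA\<^esub> single_path (a, [])"
  have ab: "single_path (a, []) \<in> carrier PA" "single_path (b, []) \<in> carrier PA"
    using assms order_pos by (auto intro!: quiver.single_path_closed simp: quiver_paths_cyclic)
  have D: "?D \<subseteq> carrier PA" by (auto simp: path_algebra_degree_def)
  have apply_c: "?c f (u, p) = (if u = b \<and> path_target (cyclic_quiver n) u p = a then f (u, p) else 0)" for f u p
    by (simp add: quiver.mult_trivial_path_apply quiver.trivial_path_mult_apply)
  have "idempotent b \<otimes> residue f \<otimes> idempotent a = residue (?c f)" if "f \<in> ?D" for f
    using ab D that by (auto simp: idempotent_def)
  then have "{idempotent b \<otimes> x \<otimes> idempotent a |x. x \<in> degree_part l} = residue ` ?c ` ?D"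
    unfolding degree_part_def by (auto simp: image_iff) metis+
  also have "?c ` ?D = quiver.supported ?X"
  proof (intro equalityI subsetI)
    fix f assume "f \<in> ?c ` ?D"
    then obtain g where g: "g \<in> ?D" "f = ?c g" by blast
    then have "f \<in> carrier PA" using ab D by auto
    then show "f \<in> quiver.supported ?X"
      using g by (auto simp: quiver.supported_def apply_c path_algebra_degree_def quiver.carrier_PA[of g]
        split: if_splits)
  next
    fix f :: "nat \<times> nat list \<Rightarrow> 'k" assume f: "f \<in> quiver.supported ?X"
    then have "f \<in> ?D" by (auto simp: quiver.supported_def path_algebra_degree_def)
    moreover have "?c f = f"
      using f by (auto simp: fun_eq_iff apply_c quiver.supported_def)
    ultimately show "f \<in> ?c ` ?D" by force
  qed
  finally show ?thesis .
qed

lemma walk_in_paths: "a \<in> {1..n} \<Longrightarrow> (a, cyclic_walk n a l) \<in> paths"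
  using order_pos by (simp add: quiver_paths_cyclic)

lemma trivial_path_nonzero: "(a, []) \<notin> zero_paths"
  using relations_nontrivial_paths by (auto simp: quiver.multiples_def)

text \<open>Relations are nontrivial, so no relation divides the trivial path at vertex 1 and its
  residue is nonzero.\<close>

lemma one_not_zero: "\<one> \<noteq> \<zero>"
proof
  assume "\<one> = \<zero>"
  then have "residue (single_path (1, [])) = \<zero>"
    using quiver.single_path_closed[OF walk_in_paths[of 1 0]] order_pos
    by (metis (no_types, lifting) atLeastAtMost_iff cyclic_walk_0 le_refl one_zeroD residue.hom_closed singletonD)
  moreover have "single_path (1, []) \<in> carrier PA"
    using quiver.single_path_closed[OF walk_in_paths[of 1 0]] order_pos by simp
  ultimately show False
    using residue_eq_zero_iff[of "single_path (1, [])"] trivial_path_nonzero[of 1]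
    by (auto simp: single_path_def)
qed

lemmas subfield = subfield_scalars[OF one_not_zero]

text \<open>The nonzero walks from \<open>a\<close> give a basis of \<open>P_a\<close>. Initial
  parts of nonzero walks are nonzero, so the lengths that occur are exactly those below
  \<open>p_a\<close>.\<close>

lemma walk_nonzero_iff:
  assumes a: "a \<in> {1..n}"
  shows "(a, cyclic_walk n a l) \<notin> zero_paths \<longleftrightarrow> l < dim_projective a"
proof -
  let ?X = "{(u, p) \<in> paths. u = a}" and ?L = "{l. (a, cyclic_walk n a l) \<notin> zero_paths}"
  have X: "?X - zero_paths = (\<lambda>l. (a, cyclic_walk n a l)) ` ?L"
    using a order_pos by (auto simp: quiver_paths_cyclic image_iff)
  have inj: "inj_on (\<lambda>l. (a, cyclic_walk n a l)) ?L"
    by (rule inj_onI) (metis length_cyclic_walk prod.inject)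
  have fin: "finite (?X - zero_paths)"
    by (rule finite_subset[OF _ finite_nonzero_paths[OF subfield]]) auto
  then have "finite ?L" unfolding X by (rule finite_imageD[OF _ inj])
  moreover have "l \<in> ?L" if "Suc l \<in> ?L" for l
    using that cyclic_walk_add[of n a l 1] quiver.multiples_append_right[of a "cyclic_walk n a l"] by auto
  ultimately have "?L = {..<card ?L}" by (rule finite_downward_closed)
  moreover have "dim_projective a = card ?L"
  proof -
    have "dim_projective a = card (?X - zero_paths)"
      unfolding dim_projective_def projective_def residue_image_left[OF a]
      by (intro dim_residue_supported[OF subfield _ fin]) auto
    then show ?thesis unfolding X card_image[OF inj] .
  qed
  ultimately show ?thesis by auto
qed

lemma dim_projective_pos: "a \<in> {1..n} \<Longrightarrow> dim_projective a > 0"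
  using walk_nonzero_iff[of a 0] trivial_path_nonzero by simp

text \<open>Deleting the first arrow of a nonzero walk leaves a nonzero walk from the next
  vertex.\<close>

lemma dim_projective_le:
  assumes "a \<in> {1..n}"
  shows "dim_projective a \<le> Suc (dim_projective (cyclic_succ n a))"
proof (rule ccontr)
  let ?b = "cyclic_succ n a"
  assume "\<not> ?thesis"
  then have "(a, [a] @ cyclic_walk n ?b (dim_projective ?b)) \<notin> zero_paths"
    using walk_nonzero_iff[OF assms, of "Suc (dim_projective ?b)"] by (simp add: cyclic_walk_Suc)
  moreover have "path_target (cyclic_quiver n) a [a] = ?b"
    using path_target_cyclic[of n a 1] by (simp add: cyclic_walk_Suc)
  ultimately have "(?b, cyclic_walk n ?b (dim_projective ?b)) \<notin> zero_paths"
    using quiver.multiples_append_left[of a "[a]"] by auto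
  then show False
    using walk_nonzero_iff[OF cyclic_succ_mem[OF order_pos assms]] by simp
qed

text \<open>There is one walk of each length from \<open>b\<close>, so every graded dimension is 0
  or 1, and all of them vanish from degree \<open>p_b\<close> on.\<close>

lemma graded_cartan_eq:
  assumes "a \<in> {1..n}" "b \<in> {1..n}"
  shows "graded_cartan a b =
    (\<Sum>l<dim_projective b. if (cyclic_succ n ^^ l) b = a then Polynomial.monom 1 l else 0)"
proof -
  let ?d = "\<lambda>l. dim (range scalar) {idempotent b \<otimes> x \<otimes> idempotent a |x. x \<in> degree_part l}"
  have d: "?d l = (if l < dim_projective b \<and> (cyclic_succ n ^^ l) b = a then 1 else 0)" for l
  proof -
    let ?X = "{(u, p) \<in> paths. u = b \<and> length p = l \<and> path_target (cyclic_quiver n) u p = a}"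
    have X: "?X - zero_paths =
        (if l < dim_projective b \<and> (cyclic_succ n ^^ l) b = a then {(b, cyclic_walk n b l)} else {})"
      using walk_nonzero_iff[OF assms(2), of l] path_target_cyclic[of n b l] order_pos assms(2)
      by (auto simp: quiver_paths_cyclic)
    have "?d l = card (?X - zero_paths)"
      unfolding residue_image_degree[OF assms] by (rule dim_residue_supported[OF subfield]) (auto simp: X)
    then show ?thesis unfolding X by simp
  qed
  show ?thesis
    unfolding graded_cartan_def d
    by (subst Sum_any.expand_superset[of "{..<dim_projective b}"])
      (auto intro!: sum.cong split: if_splits)
qed

text \<open>Row \<open>c\<close> minus \<open>t\<close> times the row of its predecessor
  \<open>a\<close>: extending a walk from \<open>b\<close> to \<open>a\<close> by one arrow gives a
  walk to \<open>c\<close>, so the terms of each column telescope.\<close>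

lemma weighting_recursion:
  assumes "is_weighting n (\<lambda>b c. Fract (graded_cartan b c) 1) \<alpha>" and c: "c \<in> {1..n}"
  shows "\<alpha> c = (1 - fract_X) +
    (\<Sum>b | b \<in> {1..n} \<and> (cyclic_succ n ^^ dim_projective b) b = c. fract_X ^ dim_projective b * \<alpha> b)"
proof -
  \<comment> \<open>For \<open>l < dim_projective b\<close> this is the term of degree
    \<open>l\<close> in row \<open>c\<close> and column \<open>b\<close> of the Cartan
    matrix.\<close>
  let ?g = "\<lambda>c b l. if (cyclic_succ n ^^ l) b = c then fract_X ^ l else (0 :: rat poly fract)"
  have Fract_sum: "Fract (\<Sum>i\<in>S. h i) 1 = (\<Sum>i\<in>S. Fract (h i) (1 :: rat poly))" for S and h :: "nat \<Rightarrow> rat poly"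
  proof -
    have add: "Fract (x + y) 1 = Fract x 1 + Fract y (1 :: rat poly)" for x y by simp
    show ?thesis
      by (induction S rule: infinite_finite_induct) (simp_all add: Zero_fract_def add del: add_fract)
  qed
  have X_power: "fract_X ^ l = Fract (Polynomial.monom (1 :: rat) l) 1" for l
    by (induction l) (simp_all add: One_fract_def monom_Suc flip: one_pCons)
  have eq: "(\<Sum>b\<in>{1..n}. (\<Sum>l<dim_projective b. ?g a b l) * \<alpha> b) = 1" if "a \<in> {1..n}" for a
  proof -
    have "(\<Sum>b\<in>{1..n}. (\<Sum>l<dim_projective b. ?g a b l) * \<alpha> b) =
        (\<Sum>b\<in>{1..n}. Fract (graded_cartan a b) 1 * \<alpha> b)"
      using that by (intro sum.cong arg_cong2[of _ _ _ _ "(*)"])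
        (auto simp: graded_cartan_eq Fract_sum X_power Zero_fract_def intro!: sum.cong)
    then show ?thesis using assms(1) that by (simp add: is_weighting_def)
  qed
  obtain a where a: "a \<in> {1..n}" "cyclic_succ n a = c"
    using c by (intro that[of "if c = 1 then n else c - 1"]) (auto simp: cyclic_succ_def)
  have shift: "?g c b (Suc l) = fract_X * ?g a b l" if "b \<in> {1..n}" for b l
  proof -
    have "(cyclic_succ n ^^ Suc l) b = c \<longleftrightarrow> (cyclic_succ n ^^ l) b = a"
      using inj_on_eq_iff[OF inj_on_cyclic_succ funpow_cyclic_succ_mem[OF order_pos that] a(1), of l] a(2) by simp
    then show ?thesis by simp
  qed
  have "1 - fract_X = (\<Sum>b\<in>{1..n}. (\<Sum>l<dim_projective b. ?g c b l) * \<alpha> b) -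
      fract_X * (\<Sum>b\<in>{1..n}. (\<Sum>l<dim_projective b. ?g a b l) * \<alpha> b)"
    unfolding eq[OF c] eq[OF a(1)] by simp
  also have "\<dots> = (\<Sum>b\<in>{1..n}. (\<Sum>l<dim_projective b. ?g c b l - ?g c b (Suc l)) * \<alpha> b)"
    unfolding sum_distrib_left[of fract_X] sum_subtractf[symmetric]
  proof (rule sum.cong)
    fix b assume "b \<in> {1..n}"
    then show "(\<Sum>l<dim_projective b. ?g c b l) * \<alpha> b - fract_X * ((\<Sum>l<dim_projective b. ?g a b l) * \<alpha> b) =
        (\<Sum>l<dim_projective b. ?g c b l - ?g c b (Suc l)) * \<alpha> b"
      by (simp only: shift sum_subtractf left_diff_distrib sum_distrib_left[symmetric] mult.assoc)
  qed simp
  also have "\<dots> = (\<Sum>b\<in>{1..n}. (?g c b 0 - ?g c b (dim_projective b)) * \<alpha> b)"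
    by (intro sum.cong refl arg_cong2[of _ _ _ _ "(*)"] sum_lessThan_telescope')
  \<comment> \<open>The lower end \<open>l = 0\<close> survives only for \<open>b = c\<close>. The
    upper end, one beyond the last nonzero walk, records the edge from \<open>b\<close> to
    \<gamma>(b).\<close>
  also have "\<dots> = (\<Sum>b\<in>{1..n}. if b = c then \<alpha> b else 0) -
      (\<Sum>b\<in>{1..n}. if (cyclic_succ n ^^ dim_projective b) b = c then fract_X ^ dim_projective b * \<alpha> b else 0)"
    unfolding sum_subtractf[symmetric] by (rule sum.cong) (auto simp: left_diff_distrib)
  also have "(\<Sum>b\<in>{1..n}. if b = c then \<alpha> b else 0) = \<alpha> c"
    using c by simp
  finally show ?thesis
    unfolding sum.inter_filter[OF finite_atLeastAtMost] by (simp only: diff_add_cancel)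
qed

end

section \<open>Cycles and components of functional digraphs\<close>

locale functional_digraph =
  fixes G :: "('v, 'v) pre_digraph"
  assumes tail: "tail G = (\<lambda>a. a)"
    and arcs: "arcs G = verts G"
    and head: "head G ` verts G \<subseteq> verts G"
begin

text \<open>As arrows are their own sources, the arrow list of a cycle is also the list of its
  vertices.\<close>

lemma cycle_orbit:
  assumes "pre_digraph.cycle G C"
  obtains u where "u \<in> verts G" "u \<in> orbit (head G) u" "set C = orbit (head G) u"
proof -
  obtain u where u: "u \<in> verts G" "pre_digraph.cas G u C u" "C \<noteq> []"
    using assms by (auto simp: pre_digraph.cycle_def pre_digraph.awalk_def)
  have C: "C = map (\<lambda>i. (head G ^^ i) u) [0..<length C]" "(head G ^^ length C) u = u"
    using u(2) cas_functional[OF tail] by auto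
  have "set C = orbit (head G) u"
    using u(3) arg_cong[OF C(1), of set]
    by (subst orbit_altdef_bounded[OF C(2)]) auto
  moreover have "u \<in> orbit (head G) u"
    using funpow_orbitI[OF C(2)] u(3) by simp
  ultimately show ?thesis using that u(1) by blast
qed

lemma cyclic_vertex_iff:
  assumes a: "a \<in> verts G"
  shows "cyclic_vertex G a \<longleftrightarrow> a \<in> orbit (head G) a"
proof
  assume "cyclic_vertex G a"
  then obtain C where "pre_digraph.cycle G C" "a \<in> set C"
    unfolding cyclic_vertex_def by (auto simp: tail)
  then show "a \<in> orbit (head G) a"
    by (metis cycle_orbit self_in_orbit_trans)
next
  assume per: "a \<in> orbit (head G) a"
  obtain m where m: "m > 0" "(head G ^^ m) a = a" "inj_on (\<lambda>i. (head G ^^ i) a) {..<m}"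
    using orbit_enum[OF per] by metis
  let ?C = "map (\<lambda>i. (head G ^^ i) a) [0..<m]"
  have mem: "(head G ^^ i) a \<in> verts G" for i using funpow_mem[OF head a] .
  \<comment> \<open>A cycle must have distinct vertices after the first. These carry indices 1 to
    \<open>m\<close>, and index \<open>m\<close> may be replaced by 0 within the injective
    range.\<close>
  have "distinct (map (\<lambda>i. (head G ^^ i) a) [1..<Suc m])"
  proof -
    have "map (\<lambda>i. (head G ^^ i) a) [1..<Suc m] = map (\<lambda>i. (head G ^^ i) a) ([1..<m] @ [0])"
      using m(1,2) by simp
    moreover have "inj_on (\<lambda>i. (head G ^^ i) a) (set ([1..<m] @ [0]))"
      using m(1) by (intro inj_on_subset[OF m(3)]) auto
    ultimately show ?thesis by (simp add: distinct_map del: map_append upt_Suc)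
  qed
  moreover have "tl (pre_digraph.awalk_verts G a ?C) = map (\<lambda>i. (head G ^^ i) a) [1..<Suc m]"
    unfolding awalk_verts_functional[OF tail] by (simp add: upt_conv_Cons del: upt_Suc)
  moreover have "pre_digraph.awalk G a ?C a"
    using cas_functional[OF tail, of a ?C a] m a mem by (auto simp: pre_digraph.awalk_def arcs)
  ultimately have "pre_digraph.cycle G ?C"
    using m(1) unfolding pre_digraph.cycle_def by auto
  moreover have "a \<in> set ?C" using m(1) by (auto simp: image_iff intro!: bexI[of _ 0])
  ultimately show "cyclic_vertex G a" unfolding cyclic_vertex_def by (auto simp: tail)
qed

text \<open>Flowing into the cycle is preserved along an edge in either direction. Conversely, two
  vertices whose forward paths meet are connected through the meeting point.\<close>

lemma component_verts_periodic:
  assumes a: "a \<in> verts G" and per: "a \<in> orbit (head G) a"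
  shows "component_verts G a = {b \<in> verts G. \<exists>k. (head G ^^ k) b \<in> orbit (head G) a}"
proof -
  let ?f = "head G" and ?r = "(\<Union>e\<in>verts G. {(e, head G e), (head G e, e)})"
  let ?S = "rtrancl_on (verts G) ?r"
  have comp: "component_verts G a = {b. (a, b) \<in> ?S}"
    by (simp add: component_verts_def reachable_def mk_symmetric_def tail arcs arcs_ends_def
      arc_to_ends_def with_proj_def)
  have walk: "(b, (?f ^^ k) b) \<in> ?S \<and> ((?f ^^ k) b, b) \<in> ?S" if "b \<in> verts G" for b k
  proof (induction k)
    case (Suc k)
    have "(?f ^^ k) b \<in> verts G" "?f ((?f ^^ k) b) \<in> verts G"
      using funpow_mem[OF head that, of k] funpow_mem[OF head that, of "Suc k"] by simp_all
    then show ?case using Suc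
      by (auto intro: rtrancl_on_into_rtrancl_on converse_rtrancl_on_into_rtrancl_on)
  qed (use that in simp)
  show ?thesis unfolding comp
  proof (intro equalityI subsetI CollectI)
    fix b assume "b \<in> {b. (a, b) \<in> ?S}"
    then have "(a, b) \<in> ?S" by simp
    then show "b \<in> verts G \<and> (\<exists>k. (?f ^^ k) b \<in> orbit ?f a)"
    proof (induction rule: rtrancl_on_induct)
      case base
      then show ?case using a per by (auto intro: exI[of _ 0])
    next
      case (step y z)
      then obtain k where k: "(?f ^^ k) y \<in> orbit ?f a" by blast
      \<comment> \<open>Along a forward edge the iterate moves one step further on the cycle; along
        a reversed edge one more iterate is taken.\<close>
      consider "z = ?f y" | "y = ?f z" using step(2) by auto
      then have "\<exists>k. (?f ^^ k) z \<in> orbit ?f a"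
      proof cases
        case 1
        then have "(?f ^^ k) z = ?f ((?f ^^ k) y)" by (simp add: funpow_swap1)
        then show ?thesis using orbit.step[OF k] by metis
      next
        case 2
        then have "(?f ^^ Suc k) z = (?f ^^ k) y" by (simp add: funpow_swap1)
        then show ?thesis using k by metis
      qed
      then show ?case using step(4) by blast
    qed
  next
    fix b assume "b \<in> {b \<in> verts G. \<exists>k. (?f ^^ k) b \<in> orbit ?f a}"
    then obtain k j where b: "b \<in> verts G" "(?f ^^ k) b = (?f ^^ j) a"
      by (auto simp: orbit_altdef)
    have "(a, (?f ^^ j) a) \<in> ?S" using walk[OF a] ..
    moreover have "((?f ^^ j) a, b) \<in> ?S" using walk[OF b(1), of k] unfolding b(2) ..
    ultimately show "(a, b) \<in> ?S" by (rule rtrancl_on_trans)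
  qed
qed

end

theorem theorem2p6:
  fixes n :: nat and \<rho> :: "(nat \<times> nat list) set"
    and A :: "('a, 'm) ring_scheme" and scalar :: "'k::field \<Rightarrow> 'a"
    and \<phi> :: "(nat \<times> nat list \<Rightarrow> 'k) set \<Rightarrow> 'a"
    and \<alpha> :: "nat \<Rightarrow> rat poly fract"
    and R :: "(nat, nat) pre_digraph" and I :: "nat list" and w :: rat and a :: nat
  assumes "nakayama_algebra n \<rho> A scalar \<phi>"
    and "is_weighting n (\<lambda>b c. Fract (nakayama_algebra.graded_cartan n \<rho> A scalar \<phi> b c) 1) \<alpha>"
    and "R = nakayama_algebra.resolution_quiver n \<rho> A scalar \<phi>"
    and "pre_digraph.cycle R I"
    and "w = nakayama_algebra.cycle_weight n \<rho> A scalar \<phi> I"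
    and "a \<in> {1..n}"
  shows "(\<not> cyclic_vertex R a \<longrightarrow> has_value_at (\<alpha> a) 1 0) \<and>
    (cyclic_vertex R a \<longrightarrow>
      has_value_at (\<alpha> a) 1 (of_nat (card (component_verts R a)) / (of_nat n * w)))"
proof -
  interpret nakayama_algebra n \<rho> A scalar \<phi> by fact
  define f where "f = (\<lambda>a. (cyclic_succ n ^^ dim_projective a) a)"
  interpret resolution_map n dim_projective f
    by unfold_locales (use order_pos dim_projective_le in \<open>auto simp: f_def\<close>)
  have fV: "f ` {1..n} \<subseteq> {1..n}"
    unfolding f_def using funpow_cyclic_succ_mem[OF order_pos] by blast
  have R: "verts R = {1..n}" "arcs R = {1..n}" "tail R = (\<lambda>a. a)" "head R = f"
    unfolding assms(3) resolution_quiver_def f_def by simp_all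
  interpret R: functional_digraph R
    by unfold_locales (use R fV in simp_all)
  have rec: "\<alpha> c = (1 - fract_X) + (\<Sum>b | b \<in> {1..n} \<and> f b = c. fract_X ^ dim_projective b * \<alpha> b)"
    if "c \<in> {1..n}" for c
    using weighting_recursion[OF assms(2) that] unfolding f_def .
  have cyclic: "cyclic_vertex R a \<longleftrightarrow> a \<in> orbit f a"
    using R.cyclic_vertex_iff[of a] assms(6) by (simp add: R)
  have "has_value_at (\<alpha> a) 1 (of_nat (card (component_verts R a)) / (of_nat n * w))"
    if per: "a \<in> orbit f a"
  proof -
    obtain u where u: "u \<in> {1..n}" "u \<in> orbit f u" "set I = orbit f u"
      using R.cycle_orbit[OF assms(4)] unfolding R .
    \<comment> \<open>The weight is read off the given cycle \<open>I\<close>, which may differ from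
      the cycle of \<open>a\<close>; equality of cycle weights transfers it.\<close>
    have "of_nat n * w = of_nat (\<Sum>b\<in>set I. dim_projective b)"
      using order_pos by (simp add: assms(5) cycle_weight_def resolution_quiver_def)
    also have "(\<Sum>b\<in>set I. dim_projective b) = (\<Sum>b\<in>orbit f a. dim_projective b)"
      unfolding u(3) by (rule cycle_weights_equal[OF u(1,2) assms(6) per])
    finally have weight: "of_nat n * w = of_nat (\<Sum>b\<in>orbit f a. dim_projective b)" .
    have "component_verts R a = {b \<in> {1..n}. \<exists>k. (f ^^ k) b \<in> orbit f a}"
      using R.component_verts_periodic[of a] assms(6) per by (simp add: R)
    \<comment> \<open>The vertex \<open>a\<close> lies on its own cycle and contributes a positive
      dimension.\<close>
    moreover have "(\<Sum>b\<in>orbit f a. dim_projective b) > 0"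
      using dim_projective_pos[OF assms(6)] per finite_orbit[OF per]
      by (metis member_le_sum order_less_le_trans zero_le)
    ultimately show ?thesis
      using weighting_periodic[OF _ fV rec assms(6) per] unfolding weight by simp
  qed
  then show ?thesis
    using weighting_nonperiodic[OF _ fV rec assms(6)] unfolding cyclic by simp
qed

end
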